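(* Let $n\ge 2$, let $(k_1,\alpha_1),\dots,(k_n,\alpha_n)$ be an admissible sequence and let $\Sigma_n\in\mathbb{R}^{n\times n}$ be the asymptotic covariance matrix in the supercritical regime. Put $a_i=\frac{k_i!}{\mu_{k_i}^{(\alpha_i)}}$ for $i\in[n]$. Then the following hold. (i) An LU decomposition $\Sigma_n=LU$ of $\Sigma_n$ is given by the matrices $L=(l_{ij})\in\mathbb{R}^{n\times n}$ and $U=(u_{ij})\in\mathbb{R}^{n\times n}$ with entries $$l_{ij}=\begin{cases}1&\text{for } i=j,\\ \frac{a_1}{a_i}&\text{for } i>1\text{ and } j=1,\\ 0&\text{else,}\end{cases}\qquad u_{ij}=\begin{cases}\frac{1}{a_1a_j}&\text{for } i=1,\\ 0&\text{else.}\end{cases}$$ (ii) A Cholesky decomposition $\Sigma_n=GG^t$ of $\Sigma_n$ is given by the matrix $G=(g_{ij})\in\mathbb{R}^{n\times n}$ with entries $$g_{ij}=\begin{cases}\frac1{a_i}&\text{for } j=1,\\ 0&\text{else.}\end{cases}$$ (iii) A matrix root $B=(b_{ij})\in\mathbb{R}^{n\times n}$ of $\Sigma_n$ (i.e., $B^2=\Sigma_n$) has entries $$b_{ij}=\frac{\prod_{k=1}^n a_k}{a_ia_j\sqrt{\sum_{l=1}^n\prod_{k\in[n]\setminus\{l\}}a_k^2}}.$$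
   Context: $[n]=\{1,\dots,n\}$. An LU decomposition has $L$ lower triangular and $U$ upper triangular; in a Cholesky decomposition (of a positive semidefinite matrix) $G$ is lower triangular. Fix $d\ge 1$ and let $B^d\subset\mathbb{R}^d$ be the unit ball. For $s>0$ and points $x_0,\dots,x_k\in\mathbb{R}^d$ with $k\le d$, $\Delta_s[x_0,\dots,x_k]$ is the $k$-dimensional volume of the convex hull of $x_0,\dots,x_k$ if all edge lengths $\|x_i-x_j\|$ are at most $s$, and $0$ otherwise; for $k>d$ the volume is replaced by $1$. Powers $\Delta_s[\cdot]^\alpha$ are understood to be $0$ when some edge length exceeds $s$. The list $\{x_l\}_{l=i}^j$ stands for $x_i,\dots,x_j$ (empty if $j<i$). Define $$\mu_k^{(\alpha)}=\int_{(B^d)^k}\Delta_1[0,\{x_l\}_{l=1}^k]^\alpha\,dx_1\cdots dx_k,$$ $$\mu_{k_1,k_2:m}^{(\alpha_1,\alpha_2)}=\int_{(B^d)^{k_1+k_2+1-m}}\Delta_1[0,\{x_l\}_{l=1}^{k_1}]^{\alpha_1}\,\Delta_1[0,\{x_l\}_{l=k_1-m+2}^{k_1+k_2-m+1}]^{\alpha_2}\,dx_1\cdots dx_{k_1+k_2+1-m}.$$ A sequence $(k_1,\alpha_1),\dots,(k_n,\alpha_n)$ (with $k_i$ integers, $\alpha_i$ real) is admissible if: $0\le k_1\le\dots\le k_n$; the pairs are distinct; $\alpha_i>-d+k_i-1$ and $\alpha_i+\alpha_j>-d+\min_{l\in\{i,j\}}k_l-1$ for all $i,j$; and $\alpha_i=0$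 if $k_i>d$. In the supercritical regime ($t\delta_t^d\to\infty$) the asymptotic covariance matrix of the normalized vector of volume power functionals $(\tilde{\mathcal V}_{k_1}^{(\alpha_1)},\dots,\tilde{\mathcal V}_{k_n}^{(\alpha_n)})$ is $$\Sigma_n=\Big(\frac{\mu_{k_i,k_j:1}^{(\alpha_i,\alpha_j)}}{k_i!\,k_j!}\Big)_{i,j=1,\dots,n}.$$ *)

theory Defs
  imports "HOL-Analysis.Analysis" "Jordan_Normal_Form.Matrix"
begin

text \<open>
  The \<open>k\<close>-dimensional volume of a set lying in some \<open>k\<close>-dimensional affine subspace, i.e. its
  \<open>k\<close>-dimensional Lebesgue measure in the coordinates given by an orthonormal frame
  \<open>e 0, \<dots>, e (k - 1)\<close> of that subspace with origin \<open>p\<close>. The value does not depend on the choice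
  of \<open>p\<close> and \<open>e\<close>. A set of smaller affine dimension has volume \<open>0\<close>; for \<open>k = 0\<close> a point has
  volume \<open>1\<close>.
\<close>

definition kvolume :: "nat \<Rightarrow> 'a::euclidean_space set \<Rightarrow> real" where
  "kvolume k S = (SOME v. \<exists>(p::'a) (e::nat \<Rightarrow> 'a).
     (\<forall>i<k. \<forall>j<k. inner (e i) (e j) = (if i = j then 1 else 0)) \<and>
     S \<subseteq> range (\<lambda>c. p + (\<Sum>i<k. c i *\<^sub>R e i)) \<and>
     v = measure (\<Pi>\<^sub>M i\<in>{..<k}. (lborel :: real measure))
           {c \<in> (\<Pi>\<^sub>E i\<in>{..<k}. (UNIV :: real set)). p + (\<Sum>i<k. c i *\<^sub>R e i) \<in> S})"

text \<open>
  The power \<open>\<Delta>\<^sub>s[x\<^sub>0, \<dots>, x\<^sub>k]\<^sup>\<alpha>\<close>, where the list \<open>xs\<close> is \<open>x\<^sub>0, \<dots>, x\<^sub>k\<close>, so that \<open>k = length xs - 1\<close>.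
  Since \<open>0 powr \<alpha> = 0\<close> for every \<open>\<alpha>\<close>, the power is also \<open>0\<close> at degenerate simplices
  (\<open>1 \<le> k \<le> d\<close>, volume \<open>0\<close>), even if \<open>\<alpha> \<le> 0\<close>; these form a null set in the integrals below.
\<close>

definition simplex_vol_powr :: "real \<Rightarrow> real \<Rightarrow> 'a::euclidean_space list \<Rightarrow> real" where
  "simplex_vol_powr s \<alpha> xs =
     (if \<forall>x\<in>set xs. \<forall>y\<in>set xs. norm (x - y) \<le> s
      then (if length xs - 1 \<le> DIM('a)
            then kvolume (length xs - 1) (convex hull (set xs)) else 1) powr \<alpha>
      else 0)"

definition vol_moment :: "'a::euclidean_space itself \<Rightarrow> nat \<Rightarrow> real \<Rightarrow> real" where
  "vol_moment _ k \<alpha> =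
     set_lebesgue_integral (\<Pi>\<^sub>M l\<in>{1..k}. (lborel :: 'a measure)) (\<Pi>\<^sub>E l\<in>{1..k}. cball 0 1)
       (\<lambda>x. simplex_vol_powr 1 \<alpha> (0 # map x [1..<k + 1]))"

text \<open>
  The mixed quantity \<open>\<mu>\<close> with indices \<open>k1, k2 : m\<close> and exponents \<open>\<alpha>1, \<alpha>2\<close>. The subtractions on
  naturals do not truncate for \<open>m \<le> min k1 k2 + 1\<close>, the range in which the definition is meant;
  the second list is \<open>x\<close> at the indices \<open>k1 - m + 2, \<dots>, k1 + k2 - m + 1\<close>.
\<close>

definition joint_vol_moment ::
    "'a::euclidean_space itself \<Rightarrow> nat \<Rightarrow> nat \<Rightarrow> nat \<Rightarrow> real \<Rightarrow> real \<Rightarrow> real" where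
  "joint_vol_moment _ k1 k2 m \<alpha>1 \<alpha>2 =
     set_lebesgue_integral (\<Pi>\<^sub>M l\<in>{1..k1 + k2 + 1 - m}. (lborel :: 'a measure))
       (\<Pi>\<^sub>E l\<in>{1..k1 + k2 + 1 - m}. cball 0 1)
       (\<lambda>x. simplex_vol_powr 1 \<alpha>1 (0 # map x [1..<k1 + 1]) *
            simplex_vol_powr 1 \<alpha>2 (0 # map x [k1 + 2 - m..<k1 + k2 + 2 - m]))"

text \<open>
  Here \<open>d\<close> is the dimension of the ambient space. The lower bounds on the exponents are required
  for all indices, hence also together with the last clause.
\<close>

definition admissible :: "nat \<Rightarrow> nat \<Rightarrow> (nat \<Rightarrow> nat) \<Rightarrow> (nat \<Rightarrow> real) \<Rightarrow> bool" where
  "admissible d n k \<alpha> \<longleftrightarrow>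
     (\<forall>i\<in>{1..n}. \<forall>j\<in>{1..n}. i \<le> j \<longrightarrow> k i \<le> k j) \<and>
     inj_on (\<lambda>i. (k i, \<alpha> i)) {1..n} \<and>
     (\<forall>i\<in>{1..n}. \<alpha> i > - real d + real (k i) - 1) \<and>
     (\<forall>i\<in>{1..n}. \<forall>j\<in>{1..n}. \<alpha> i + \<alpha> j > - real d + real (min (k i) (k j)) - 1) \<and>
     (\<forall>i\<in>{1..n}. k i > d \<longrightarrow> \<alpha> i = 0)"

text \<open>The \<open>n \<times> n\<close> matrix with entries \<open>f i j\<close> for \<open>i, j \<in> {1..n}\<close>; the library indexes from \<open>0\<close>.\<close>

definition one_based_mat :: "nat \<Rightarrow> (nat \<Rightarrow> nat \<Rightarrow> 'b) \<Rightarrow> 'b mat" where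
  "one_based_mat n f = Matrix.mat n n (\<lambda>(i, j). f (i + 1) (j + 1))"

text \<open>The asymptotic covariance matrix in the supercritical regime.\<close>

definition supercritical_cov ::
    "'a::euclidean_space itself \<Rightarrow> nat \<Rightarrow> (nat \<Rightarrow> nat) \<Rightarrow> (nat \<Rightarrow> real) \<Rightarrow> real mat" where
  "supercritical_cov T n k \<alpha> =
     one_based_mat n (\<lambda>i j. joint_vol_moment T (k i) (k j) 1 (\<alpha> i) (\<alpha> j) / (fact (k i) * fact (k j)))"

definition lower_triangular :: "'b::zero mat \<Rightarrow> bool" where
  "lower_triangular A \<longleftrightarrow> (\<forall>i<dim_row A. \<forall>j<dim_col A. i < j \<longrightarrow> A $$ (i, j) = 0)"

definition lu_decomposition :: "nat \<Rightarrow> real mat \<Rightarrow> real mat \<Rightarrow> real mat \<Rightarrow> bool" where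
  "lu_decomposition n A L U \<longleftrightarrow>
     L \<in> carrier_mat n n \<and> U \<in> carrier_mat n n \<and>
     lower_triangular L \<and> upper_triangular U \<and> A = L * U"

definition pos_semidefinite :: "nat \<Rightarrow> real mat \<Rightarrow> bool" where
  "pos_semidefinite n A \<longleftrightarrow>
     A \<in> carrier_mat n n \<and> transpose_mat A = A \<and>
     (\<forall>v\<in>carrier_vec n. scalar_prod v (A *\<^sub>v v) \<ge> 0)"

definition cholesky_decomposition :: "nat \<Rightarrow> real mat \<Rightarrow> real mat \<Rightarrow> bool" where
  "cholesky_decomposition n A G \<longleftrightarrow>
     pos_semidefinite n A \<and> G \<in> carrier_mat n n \<and> lower_triangular G \<and> A = G * transpose_mat G"

end

theory Submission
  imports Defs
begin

text \<open>
  With \<open>b\<^sub>i = \<mu> / k\<^sub>i! = 1 / a\<^sub>i\<close> the two simplices in \<open>\<mu>\<close> with index \<open>k\<^sub>i, k\<^sub>j : 1\<close> share only the origin, so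
  Fubini makes the covariance matrix the rank one matrix \<open>b b\<^sup>t\<close>, and the decompositions are
  algebra as soon as all moments are nonzero, that is, finite and positive. For this, the volume of
  the simplex is \<open>\<Prod> norm (g\<^sub>i) / k!\<close>, where the \<open>g\<^sub>i\<close> are the Gram-Schmidt vectors of its edges at
  the origin. The norm of \<open>g\<^sub>i\<close> is the distance of the \<open>i\<close>-th vertex to a subspace of dimension
  at most \<open>i - 1\<close>, and a negative power \<open>\<alpha>\<close> of it is integrable when \<open>\<alpha> > - d + i - 1\<close>. Integrating
  out the vertices one after the other gives finiteness of the moment. Applied to \<open>\<alpha> = - 1/2\<close>, it
  also shows that almost all simplices are nondegenerate, hence positivity.
\<close>

section \<open>Orthonormal frames and Lebesgue measure\<close>

text \<open>The volume in \<open>kvolume\<close> is a Hilbert choice among all origins and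
  orthonormal frames whose affine span contains the set, so its value is known only once all choices
  are shown to agree. For a simplex an arbitrary choice is evaluated: thickened by a unit cube in
  the complementary directions, the simplex becomes a linear image of a fixed body of full
  dimension, where the determinant formula applies. The Gram-Schmidt form of that determinant suits
  iterated integration, because the last vertex enters only the last factor. Finiteness of the
  moments is a real issue: a divergent real integral counts as 0, and the \<open>a i\<close>, by
  which the factorizations divide, would then be 0 as well. For negative \<open>\<alpha>\<close> the
  condition \<open>\<alpha> > - d + k - 1\<close> is the requirement at the last vertex, where the
  codimension is smallest, so it covers all vertices at once. The estimate for one vertex has to be
  uniform in its predecessors, so that it leaves the outer integral as a constant.\<close>

no_notation vec_index (infixl "$" 100)
no_notation scalar_prod (infix "\<bullet>" 70)
hide_const (open) Matrix.orthogonal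

text \<open>The change of variables theorem of the library is stated for \<open>real ^ 'n\<close> with a well-ordered
  index type \<open>'n\<close>, hence this copy of the numbers below the dimension.\<close>

typedef (overloaded) 'a dim_index = "{..<DIM('a::euclidean_space)}"
  morphisms index_nat nat_index
  using DIM_positive by blast

lemma bij_betw_index_nat: "bij_betw index_nat (UNIV :: 'a::euclidean_space dim_index set) {..<DIM('a)}"
  using type_definition.Rep_range[OF type_definition_dim_index, where 'a1 = 'a]
  by (auto simp: bij_betw_def inj_on_def index_nat_inject)

lemma index_nat_less: "index_nat (i :: 'a::euclidean_space dim_index) < DIM('a)"
  using index_nat[of i] by simp

lemma sum_index_nat: "(\<Sum>i\<in>UNIV. f (index_nat (i :: 'a::euclidean_space dim_index))) = (\<Sum>i<DIM('a). f i)"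
  using sum.reindex_bij_betw[OF bij_betw_index_nat] .

lemma prod_index_nat: "(\<Prod>i\<in>UNIV. f (index_nat (i :: 'a::euclidean_space dim_index))) = (\<Prod>i<DIM('a). f i)"
  using prod.reindex_bij_betw[OF bij_betw_index_nat] .

instantiation dim_index :: (euclidean_space) linorder
begin

definition less_eq_dim_index :: "'a dim_index \<Rightarrow> 'a dim_index \<Rightarrow> bool" where
  "i \<le> j \<longleftrightarrow> index_nat i \<le> index_nat j"

definition less_dim_index :: "'a dim_index \<Rightarrow> 'a dim_index \<Rightarrow> bool" where
  "i < j \<longleftrightarrow> index_nat i < index_nat j"

instance
  by standard (auto simp: less_eq_dim_index_def less_dim_index_def index_nat_inject)

end

instance dim_index :: (euclidean_space) finite
proof
  show "finite (UNIV :: 'a dim_index set)"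
    using bij_betw_finite[OF bij_betw_index_nat] by blast
qed

instance dim_index :: (euclidean_space) wellorder
proof
  fix P :: "'a dim_index \<Rightarrow> bool" and i
  assume *: "\<And>i. (\<And>j. j < i \<Longrightarrow> P j) \<Longrightarrow> P i"
  show "P i"
    by (induction i rule: measure_induct_rule[where f = index_nat])
      (use * in \<open>auto simp: less_dim_index_def\<close>)
qed

section \<open>Orthonormal families, their extension and expansion\<close>

definition orthonormal :: "nat \<Rightarrow> (nat \<Rightarrow> 'a::real_inner) \<Rightarrow> bool" where
  "orthonormal n e \<longleftrightarrow> (\<forall>i<n. \<forall>j<n. e i \<bullet> e j = (if i = j then 1 else 0))"

lemma orthonormalD: "orthonormal n e \<Longrightarrow> i < n \<Longrightarrow> j < n \<Longrightarrow> e i \<bullet> e j = (if i = j then 1 else 0)"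
  by (simp add: orthonormal_def)

lemma orthonormal_mono: "orthonormal n e \<Longrightarrow> m \<le> n \<Longrightarrow> orthonormal m e"
  by (simp add: orthonormal_def)

lemma orthonormal_inj_on: "orthonormal n e \<Longrightarrow> inj_on e {..<n}"
  unfolding orthonormal_def inj_on_def by (metis lessThan_iff zero_neq_one)

lemma orthonormal_independent:
  assumes "orthonormal n e"
  shows "independent (e ` {..<n})"
proof (rule pairwise_orthogonal_independent)
  show "pairwise orthogonal (e ` {..<n})"
    using assms by (auto simp: orthonormal_def pairwise_def Linear_Algebra.orthogonal_def)
  show "0 \<notin> e ` {..<n}"
    using assms unfolding orthonormal_def by force
qed

lemma orthonormal_le_DIM:
  fixes e :: "nat \<Rightarrow> 'a::euclidean_space"
  assumes "orthonormal n e"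
  shows "n \<le> DIM('a)"
  using independent_bound[OF orthonormal_independent[OF assms]]
    card_image[OF orthonormal_inj_on[OF assms]] by simp

lemma orthogonal_span_iff:
  fixes y :: "'a::euclidean_space"
  shows "(\<forall>x\<in>span S. orthogonal x y) \<longleftrightarrow> (\<forall>x\<in>S. orthogonal x y)"
proof
  assume "\<forall>x\<in>span S. orthogonal x y"
  then show "\<forall>x\<in>S. orthogonal x y"
    by (simp add: span_base)
next
    assume *: "\<forall>x\<in>S. orthogonal x y"
    then have **: "\<And>x. x \<in> S \<Longrightarrow> orthogonal y x" by (simp add: Linear_Algebra.orthogonal_def inner_commute)
    show "\<forall>x\<in>span S. orthogonal x y"
    proof
      fix x assume "x \<in> span S"
      from orthogonal_to_span[OF this **] show "orthogonal x y"
        by (simp add: Linear_Algebra.orthogonal_def inner_commute)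
    qed
qed

text \<open>The orthogonal complement of the given vectors has dimension \<open>DIM('a) - n\<close>;
  an orthonormal basis of it, shifted by \<open>n\<close>, fills the free positions.\<close>

lemma orthonormal_extend:
  fixes e :: "nat \<Rightarrow> 'a::euclidean_space"
  assumes e: "orthonormal n e"
  obtains e' where "orthonormal DIM('a) e'" "\<And>i. i < n \<Longrightarrow> e' i = e i"
proof -
  let ?S = "e ` {..<n}"
  let ?C = "{y. \<forall>x\<in>?S. orthogonal x y}"
  have n: "n \<le> DIM('a)" by (rule orthonormal_le_DIM[OF e])
  have sub: "subspace ?C"
    by (rule subspace_orthogonal_to_vectors)
  obtain B where B: "B \<subseteq> ?C" "pairwise orthogonal B" "\<And>x. x \<in> B \<Longrightarrow> norm x = 1"
    "independent B" "card B = dim ?C" "span B = ?C"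
    by (rule orthonormal_basis_subspace[OF sub]) (rule that)
  have "dim {y \<in> UNIV. \<forall>x\<in>span ?S. orthogonal x y} + dim (span ?S) = dim (UNIV :: 'a set)"
    by (rule dim_subspace_orthogonal_to_vectors[OF subspace_span subspace_UNIV subset_UNIV])
  moreover have "{y \<in> UNIV. \<forall>x\<in>span ?S. orthogonal x y} = ?C"
    by (simp add: orthogonal_span_iff)
  moreover have "dim (span ?S) = n"
    using dim_eq_card_independent[OF orthonormal_independent[OF e]]
      card_image[OF orthonormal_inj_on[OF e]] by simp
  ultimately have card_B: "card B = DIM('a) - n"
    using B(5) by simp
  have "finite B" using B(4) independent_imp_finite by blast
  then obtain f where f: "bij_betw f {..<DIM('a) - n} B"
    using ex_bij_betw_nat_finite[of B] card_B by (auto simp: atLeast0LessThan)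
  define e' where "e' i = (if i < n then e i else f (i - n))" for i
  have fB: "f (i - n) \<in> B" if "i < DIM('a)" "\<not> i < n" for i
    using f that by (auto simp: bij_betw_def)
  have eB: "e i \<bullet> b = 0" "b \<bullet> e i = 0" if "i < n" "b \<in> B" for i b
    using B(1) that by (auto simp: Linear_Algebra.orthogonal_def subset_eq inner_commute)
  have "f (i - n) \<bullet> f (j - n) = (if i = j then 1 else 0)"
    if ij: "i < DIM('a)" "j < DIM('a)" "\<not> i < n" "\<not> j < n" for i j
  proof (cases "i = j")
    case True
    then show ?thesis using B(3)[OF fB] ij by (simp add: norm_eq_1)
  next
    case False
    have "i - n < DIM('a) - n" "j - n < DIM('a) - n" "i - n \<noteq> j - n"
      using ij False by linarith+
    then have "f (i - n) \<noteq> f (j - n)"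
      using inj_onD[OF bij_betw_imp_inj_on[OF f], of "i - n" "j - n"] by auto
    then show ?thesis
      using B(2) fB ij False by (auto simp: pairwise_def Linear_Algebra.orthogonal_def)
  qed
  then have "orthonormal DIM('a) e'"
    using e eB fB unfolding orthonormal_def e'_def by auto
  moreover have "\<And>i. i < n \<Longrightarrow> e' i = e i" by (simp add: e'_def)
  ultimately show thesis by (rule that)
qed

text \<open>The remainder is orthogonal to every \<open>e j\<close>, hence to their span; this is
  the whole space by counting dimensions, so the remainder is orthogonal to itself.\<close>

lemma orthonormal_expand:
  fixes e :: "nat \<Rightarrow> 'a::euclidean_space"
  assumes e: "orthonormal DIM('a) e"
  shows "(\<Sum>i<DIM('a). (x \<bullet> e i) *\<^sub>R e i) = x"
proof -
  let ?y = "x - (\<Sum>i<DIM('a). (x \<bullet> e i) *\<^sub>R e i)"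
  have "?y \<bullet> e j = 0" if "j < DIM('a)" for j
  proof -
    have "(\<Sum>i<DIM('a). (x \<bullet> e i) *\<^sub>R e i) \<bullet> e j = (\<Sum>i<DIM('a). if i = j then x \<bullet> e j else 0)"
      unfolding inner_sum_left using that orthonormalD[OF e]
      by (intro sum.cong) auto
    then show ?thesis using that by (simp add: inner_diff_left)
  qed
  then have 1: "orthogonal ?y y" if "y \<in> e ` {..<DIM('a)}" for y
    using that by (auto simp: Linear_Algebra.orthogonal_def)
  have "span (e ` {..<DIM('a)}) = UNIV"
    using orthonormal_independent[OF e] card_image[OF orthonormal_inj_on[OF e]]
    by (metis card_lessThan dim_UNIV dim_eq_card_independent dim_eq_full)
  then have "?y \<in> span (e ` {..<DIM('a)})" by simp
  from orthogonal_to_span[OF this 1] have "orthogonal ?y ?y" .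
  then show ?thesis by (simp add: Linear_Algebra.orthogonal_def)
qed

lemma orthonormal_inner_expand:
  fixes e :: "nat \<Rightarrow> 'a::euclidean_space"
  assumes e: "orthonormal DIM('a) e"
  shows "(\<Sum>i<DIM('a). (x \<bullet> e i) * (y \<bullet> e i)) = x \<bullet> y"
  by (subst (3) orthonormal_expand[OF e, symmetric]) (simp add: inner_sum_right inner_commute)

text \<open>Serves two purposes: for an orthonormal family it is an isometry with inverse
  \<open>coords e\<close>, and for edge vectors it maps a standard body onto the thickened
  simplex.\<close>

definition lincomb :: "(nat \<Rightarrow> 'a::euclidean_space) \<Rightarrow> real ^ 'a dim_index \<Rightarrow> 'a" where
  "lincomb e w = (\<Sum>i\<in>UNIV. w $ i *\<^sub>R e (index_nat i))"

lemma linear_lincomb: "linear (lincomb e)"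
  by (auto simp: lincomb_def linear_iff algebra_simps sum.distrib scaleR_sum_right)

lemma lincomb_inner:
  fixes e :: "nat \<Rightarrow> 'a::euclidean_space"
  assumes e: "orthonormal DIM('a) e"
  shows "lincomb e w \<bullet> e (index_nat i) = w $ i"
proof -
  have "lincomb e w \<bullet> e (index_nat i) = (\<Sum>j\<in>UNIV. if j = i then w $ i else 0)"
    unfolding lincomb_def inner_sum_left
    using orthonormalD[OF e index_nat_less index_nat_less]
    by (intro sum.cong) (auto simp: index_nat_inject)
  then show ?thesis by simp
qed

definition coords :: "(nat \<Rightarrow> 'a::euclidean_space) \<Rightarrow> 'a \<Rightarrow> real ^ 'a dim_index" where
  "coords e x = (\<chi> i. x \<bullet> e (index_nat i))"

lemma lincomb_coords: "orthonormal DIM('a) e \<Longrightarrow> lincomb e (coords e x) = (x :: 'a::euclidean_space)"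
  using orthonormal_expand[of e x] sum_index_nat[where 'a = 'a, of "\<lambda>i. (x \<bullet> e i) *\<^sub>R e i"]
  by (simp add: lincomb_def coords_def)

lemma coords_lincomb: "orthonormal DIM('a) e \<Longrightarrow> coords e (lincomb e w) = w"
  for e :: "nat \<Rightarrow> 'a::euclidean_space"
  by (simp add: coords_def lincomb_inner Finite_Cartesian_Product.vec_eq_iff)

lemma linear_coords: "linear (coords e)"
  by (simp add: coords_def linear_iff Finite_Cartesian_Product.vec_eq_iff inner_add_left)

lemma coords_inner: "orthonormal DIM('a) e \<Longrightarrow> coords e x \<bullet> coords e y = x \<bullet> (y :: 'a::euclidean_space)"
  using orthonormal_inner_expand[of e x y] sum_index_nat[where 'a = 'a, of "\<lambda>i. (x \<bullet> e i) * (y \<bullet> e i)"]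
  by (simp add: coords_def inner_vec_def)

lemma ex_orthonormal_Basis:
  obtains b :: "nat \<Rightarrow> 'a::euclidean_space" where "bij_betw b {..<DIM('a)} Basis" "orthonormal DIM('a) b"
proof -
  obtain b :: "nat \<Rightarrow> 'a" where b: "bij_betw b {..<DIM('a)} Basis"
    using ex_bij_betw_nat_finite[OF finite_Basis] by (auto simp: atLeast0LessThan)
  moreover have "orthonormal DIM('a) b"
    using b bij_betwE[OF b] unfolding orthonormal_def by (auto simp: inner_Basis bij_betw_def inj_on_def)
  ultimately show thesis by (rule that)
qed

section \<open>Rotation invariance of Lebesgue measure\<close>

lemma measurable_linear: "linear f \<Longrightarrow> f \<in> borel_measurable borel"
  for f :: "'a::euclidean_space \<Rightarrow> 'b::euclidean_space"
  by (intro borel_measurable_continuous_onI linear_continuous_on linear_linear[THEN iffD1] )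
    (simp add: linear_conv_bounded_linear)

text \<open>Boxes determine Lebesgue measure, and the preimage of a box is its image under the
  inverse isometry, which has the same volume.\<close>

lemma lborel_distr_orthogonal:
  fixes f :: "real ^ 'n::{finite,wellorder} \<Rightarrow> real ^ 'n::_"
  assumes f: "orthogonal_transformation f"
  shows "distr lborel borel f = lborel"
proof (rule sym, rule lborel_eqI)
  fix l u :: "real ^ 'n::_"
  assume lu: "\<And>b. b \<in> Basis \<Longrightarrow> l \<bullet> b \<le> u \<bullet> b"
  let ?g = "inv_into UNIV f"
  have inv: "orthogonal_transformation ?g" using orthogonal_transformation_inv[OF f] .
  have "f -` box l u = ?g ` box l u"
    using bij_vimage_eq_inv_image[OF orthogonal_transformation_bij[OF f]] .
  moreover have "measure lebesgue (?g ` box l u) = measure lebesgue (box l u)"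
    by (rule measure_orthogonal_image[OF inv]) simp
  moreover have "?g ` box l u \<in> lmeasurable"
    by (rule measurable_orthogonal_image[OF inv]) simp
  ultimately have "emeasure lebesgue (f -` box l u) = emeasure lebesgue (box l u)"
    by (metis emeasure_eq_measure2 fmeasurableD lmeasurable_box)
  moreover have *: "f -` box l u \<in> sets borel"
    using measurable_sets[OF measurable_linear[OF orthogonal_transformation_linear[OF f]], of "box l u"] by simp
  ultimately have "emeasure lborel (f -` box l u) = emeasure lborel (box l u)"
    by simp
  then show "emeasure (distr lborel borel f) (box l u) = (\<Prod>b\<in>Basis. (u - l) \<bullet> b)"
    using lu measurable_linear[OF orthogonal_transformation_linear[OF f]]
    by (simp add: emeasure_distr emeasure_lborel_box)
qed simp

lemma prod_Basis_cart: "(\<Prod>b\<in>Basis. f b) = (\<Prod>i\<in>UNIV. f (axis i (1::real)))"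
  by (subst prod.reindex_bij_betw[where h = "\<lambda>i. axis i 1" and S = UNIV and T = Basis, symmetric])
    (auto simp: bij_betw_def inj_on_def axis_eq_axis Basis_vec_def)

text \<open>For a frame \<open>b\<close> that enumerates \<open>Basis\<close> the map only relabels
  coordinates, so boxes correspond to boxes. Any other frame differs from \<open>b\<close> by an
  orthogonal transformation of the coordinate space.\<close>

lemma lborel_distr_lincomb:
  fixes e :: "nat \<Rightarrow> 'a::euclidean_space"
  assumes e: "orthonormal DIM('a) e"
  shows "distr lborel borel (lincomb e) = lborel"
proof -
  obtain b :: "nat \<Rightarrow> 'a" where b: "bij_betw b {..<DIM('a)} Basis" "orthonormal DIM('a) b"
    by (rule ex_orthonormal_Basis)
  have 1: "distr lborel borel (lincomb b) = lborel"
  proof (rule sym, rule lborel_eqI)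
    fix l u :: 'a
    assume lu: "\<And>b. b \<in> Basis \<Longrightarrow> l \<bullet> b \<le> u \<bullet> b"
    have "(w \<in> lincomb b -` box l u) = (w \<in> box (coords b l) (coords b u))" for w
    proof -
      have "(w \<in> lincomb b -` box l u) \<longleftrightarrow> (\<forall>i<DIM('a). l \<bullet> b i < lincomb b w \<bullet> b i \<and> lincomb b w \<bullet> b i < u \<bullet> b i)"
        using bij_betw_ball[OF b(1), of "\<lambda>c. l \<bullet> c < lincomb b w \<bullet> c \<and> lincomb b w \<bullet> c < u \<bullet> c"]
        by (auto simp: mem_box)
      also have "\<dots> \<longleftrightarrow> (\<forall>i::'a dim_index. l \<bullet> b (index_nat i) < w $ i \<and> w $ i < u \<bullet> b (index_nat i))"
        (is "?L \<longleftrightarrow> ?R")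
      proof
        assume ?L then show ?R using index_nat_less lincomb_inner[OF b(2)] by metis
      next
        assume R: ?R
        show ?L
        proof (intro allI impI)
          fix i assume "i < DIM('a)"
          then have "index_nat (nat_index i :: 'a dim_index) = i" by (simp add: nat_index_inverse)
          then show "l \<bullet> b i < lincomb b w \<bullet> b i \<and> lincomb b w \<bullet> b i < u \<bullet> b i"
            using R[THEN spec, of "nat_index i"] lincomb_inner[OF b(2), of w "nat_index i"] by simp
        qed
      qed
      finally show ?thesis by (simp add: mem_box_cart coords_def)
    qed
    then have "lincomb b -` box l u = box (coords b l) (coords b u)" by blast
    then have "emeasure (distr lborel borel (lincomb b)) (box l u) = emeasure lborel (box (coords b l) (coords b u))"
      using measurable_linear[OF linear_lincomb, of b] by (simp add: emeasure_distr)
    also have "\<dots> = (\<Prod>c\<in>Basis. (coords b u - coords b l) \<bullet> c)"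
    proof (rule emeasure_lborel_box)
      fix c :: "real ^ 'a dim_index" assume "c \<in> Basis"
      then obtain i where "c = axis i 1" by (auto simp: Basis_vec_def)
      then show "coords b l \<bullet> c \<le> coords b u \<bullet> c"
        using lu[of "b (index_nat i)"] b(1) index_nat_less[of i]
        by (auto simp: coords_def inner_axis bij_betw_def)
    qed
    also have "(\<Prod>c\<in>Basis. (coords b u - coords b l) \<bullet> c) = (\<Prod>c\<in>Basis. (u - l) \<bullet> c)"
      using prod_index_nat[where 'a = 'a, of "\<lambda>i. (u - l) \<bullet> b i"] prod.reindex_bij_betw[OF b(1), of "\<lambda>c. (u - l) \<bullet> c"]
      by (simp add: prod_Basis_cart coords_def inner_axis inner_diff_left)
    finally show "emeasure (distr lborel borel (lincomb b)) (box l u) = (\<Prod>b\<in>Basis. (u - l) \<bullet> b)" .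
  qed simp
  let ?T = "coords b \<circ> lincomb e"
  have lT: "linear ?T" by (intro linear_compose linear_lincomb linear_coords)
  have "?T v \<bullet> ?T w = v \<bullet> w" for v w
    using coords_inner[OF e, of "lincomb e v" "lincomb e w"]
    by (simp add: coords_inner[OF b(2)] coords_lincomb[OF e])
  then have T: "orthogonal_transformation ?T"
    using lT by (simp add: orthogonal_transformation_def)
  have "lincomb e = lincomb b \<circ> ?T"
    by (auto simp: lincomb_coords[OF b(2)])
  then have "distr lborel borel (lincomb e) = distr (distr lborel borel ?T) borel (lincomb b)"
    using measurable_linear[OF linear_lincomb, of b] measurable_linear[OF lT] 
    by (subst distr_distr) auto
  then show ?thesis by (simp only: lborel_distr_orthogonal[OF T] 1)
qed

text \<open>Tonelli along the axes of an arbitrary frame, which rotation invariance reduces to the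
  standard axes.\<close>

lemma nn_integral_orthonormal_prod:
  fixes e :: "nat \<Rightarrow> 'a::euclidean_space" and f :: "nat \<Rightarrow> real \<Rightarrow> ennreal"
  assumes e: "orthonormal DIM('a) e" and [measurable]: "\<And>i. f i \<in> borel_measurable borel"
  shows "(\<integral>\<^sup>+x. (\<Prod>i<DIM('a). f i (x \<bullet> e i)) \<partial>lborel) = (\<Prod>i<DIM('a). \<integral>\<^sup>+t. f i t \<partial>lborel)"
proof -
  \<comment> \<open>Re-indexes \<open>f\<close> by basis vectors; an axis determines its index, so
    the description is well defined.\<close>
  define g :: "real ^ 'a dim_index \<Rightarrow> real \<Rightarrow> ennreal" where
    "g c = f (index_nat (THE i. c = axis i 1))" for c
  have g: "g (axis i 1) = f (index_nat i)" for i
    by (simp add: g_def axis_eq_axis)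
  have "(\<integral>\<^sup>+x. (\<Prod>i<DIM('a). f i (x \<bullet> e i)) \<partial>lborel) =
      (\<integral>\<^sup>+x. (\<Prod>i<DIM('a). f i (x \<bullet> e i)) \<partial>distr lborel borel (lincomb e))"
    by (simp only: lborel_distr_lincomb[OF e])
  also have "\<dots> = (\<integral>\<^sup>+w. (\<Prod>i<DIM('a). f i (lincomb e w \<bullet> e i)) \<partial>lborel)"
    using measurable_linear[OF linear_lincomb, of e] by (subst nn_integral_distr) auto
  also have "\<dots> = (\<integral>\<^sup>+w. (\<Prod>c\<in>Basis. g c (w \<bullet> c)) \<partial>lborel)"
    by (intro nn_integral_cong)
      (simp add: prod_Basis_cart g inner_axis prod_index_nat[symmetric] lincomb_inner[OF e])
  also have "\<dots> = (\<Prod>c\<in>Basis. \<integral>\<^sup>+t. g c t \<partial>lborel)"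
    by (rule nn_integral_lborel_prod) (auto simp: g_def)
  also have "\<dots> = (\<Prod>i<DIM('a). \<integral>\<^sup>+t. f i t \<partial>lborel)"
    by (simp add: prod_Basis_cart g prod_index_nat[symmetric])
  finally show ?thesis .
qed

section \<open>Volume of a simplex\<close>

text \<open>The vectors are not normalized. A vector \<open>0\<close> contributes nothing to the later ones
  (the coefficient is \<open>0 / 0 = 0\<close>), so linearly dependent inputs are allowed.\<close>

fun gram_schmidt :: "(nat \<Rightarrow> 'a::real_inner) \<Rightarrow> nat \<Rightarrow> 'a" where
  "gram_schmidt z n = z n - (\<Sum>j<n. (z n \<bullet> gram_schmidt z j / (gram_schmidt z j \<bullet> gram_schmidt z j)) *\<^sub>R gram_schmidt z j)"

declare gram_schmidt.simps [simp del]

lemma gram_schmidt_cong: "(\<And>i. i \<le> n \<Longrightarrow> z i = z' i) \<Longrightarrow> gram_schmidt z n = gram_schmidt z' n"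
proof (induction n rule: less_induct)
  case (less n)
  then have "gram_schmidt z j = gram_schmidt z' j" if "j < n" for j
    using that by simp
  then show ?case using less.prems[of n] by (simp add: gram_schmidt.simps[of _ n])
qed

lemma gram_schmidt_orthogonal_less: "j < n \<Longrightarrow> gram_schmidt z n \<bullet> gram_schmidt z j = 0"
proof (induction n arbitrary: j rule: less_induct)
  case (less n)
  let ?g = "gram_schmidt z"
  have orth: "?g i \<bullet> ?g j = 0" if "i < n" "i \<noteq> j" for i
    using less.IH[of i j] less.IH[of j i] that less.prems
    by (cases i j rule: linorder_cases) (auto simp: inner_commute)
  have "(\<Sum>i<n. (z n \<bullet> ?g i / (?g i \<bullet> ?g i)) *\<^sub>R ?g i) \<bullet> ?g j =
      (\<Sum>i<n. if i = j then (z n \<bullet> ?g j / (?g j \<bullet> ?g j)) * (?g j \<bullet> ?g j) else 0)"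
    unfolding inner_sum_left by (intro sum.cong) (auto simp: orth)
  \<comment> \<open>If \<open>?g j = 0\<close>, the quotient is 0 by convention, but so is
    \<open>z n \<bullet> ?g j\<close>, and the identity survives.\<close>
  also have "\<dots> = z n \<bullet> ?g j"
    using less.prems by simp
  finally show ?case
    by (simp add: gram_schmidt.simps[of z n] inner_diff_left)
qed

lemma gram_schmidt_orthogonal: "i \<noteq> j \<Longrightarrow> gram_schmidt z i \<bullet> gram_schmidt z j = 0"
  using gram_schmidt_orthogonal_less[of i j z] gram_schmidt_orthogonal_less[of j i z]
  by (cases i j rule: linorder_cases) (auto simp: inner_commute)

text \<open>The new vector is orthogonal to everything subtracted from \<open>z n\<close>, so its
  squared norm is its inner product with \<open>z n\<close>, and Cauchy-Schwarz applies.\<close>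

lemma norm_gram_schmidt_le: "norm (gram_schmidt z n) \<le> norm (z n)"
proof -
  have "gram_schmidt z n \<bullet> gram_schmidt z n = gram_schmidt z n \<bullet> z n"
    by (subst (2) gram_schmidt.simps) (simp add: inner_diff_right inner_sum_right gram_schmidt_orthogonal)
  then have "norm (gram_schmidt z n) * norm (gram_schmidt z n) \<le> norm (gram_schmidt z n) * norm (z n)"
    using norm_cauchy_schwarz[of "gram_schmidt z n" "z n"] by (simp add: power2_norm_eq_inner[symmetric] power2_eq_square)
  then show ?thesis by (cases "gram_schmidt z n = 0") auto
qed

lemma gram_schmidt_measurable:
  fixes z :: "'b \<Rightarrow> nat \<Rightarrow> 'a::euclidean_space"
  assumes "\<And>i. i \<le> n \<Longrightarrow> (\<lambda>x. z x i) \<in> borel_measurable M"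
  shows "(\<lambda>x. gram_schmidt (z x) n) \<in> borel_measurable M"
  using assms
proof (induction n rule: less_induct)
  case (less n)
  have [measurable]: "(\<lambda>x. gram_schmidt (z x) j) \<in> borel_measurable M" if "j \<in> {..<n}" for j
    using less that by simp
  have [measurable]: "(\<lambda>x. z x n) \<in> borel_measurable M" using less.prems by simp
  show ?case by (subst gram_schmidt.simps) measurable
qed

text \<open>The rows factor as \<open>X = R ** Y\<close> with \<open>R\<close> unit lower
  triangular, so only the rows \<open>?g j\<close> of \<open>Y\<close> matter. These are orthogonal,
  hence \<open>Y\<close> times its transpose is diagonal with the squared norms as entries.
  Dependent \<open>z\<close> are included, both sides then being 0.\<close>

lemma abs_det_eq_prod_gram_schmidt:
  fixes e z :: "nat \<Rightarrow> 'a::euclidean_space"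
  assumes e: "orthonormal DIM('a) e"
  shows "\<bar>det (matrix (coords e \<circ> lincomb z))\<bar> = (\<Prod>i<DIM('a). norm (gram_schmidt z i))"
proof -
  let ?g = "gram_schmidt z"
  define X :: "real ^ 'a dim_index ^ 'a dim_index" where "X = (\<chi> j i. z (index_nat j) \<bullet> e (index_nat i))"
  define Y :: "real ^ 'a dim_index ^ 'a dim_index" where "Y = (\<chi> j i. ?g (index_nat j) \<bullet> e (index_nat i))"
  define c where "c j i = (if i = j then 1 else if i < j then z j \<bullet> ?g i / (?g i \<bullet> ?g i) else 0)" for i j
  define R :: "real ^ 'a dim_index ^ 'a dim_index" where "R = (\<chi> j i. c (index_nat j) (index_nat i))"
  have z: "z j = (\<Sum>i<DIM('a). c j i *\<^sub>R ?g i)" if "j < DIM('a)" for j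
  proof -
    have "(\<Sum>i<DIM('a). c j i *\<^sub>R ?g i) = (\<Sum>i\<in>{..j}. c j i *\<^sub>R ?g i)"
      using that by (intro sum.mono_neutral_right) (auto simp: c_def)
    also have "\<dots> = ?g j + (\<Sum>i<j. (z j \<bullet> ?g i / (?g i \<bullet> ?g i)) *\<^sub>R ?g i)"
      by (simp add: c_def lessThan_Suc_atMost[symmetric])
    also have "\<dots> = z j" by (subst (1) gram_schmidt.simps) simp
    finally show ?thesis by simp
  qed
  have "X = R ** Y"
  proof -
    have "z (index_nat j) \<bullet> e (index_nat i) = (\<Sum>k\<in>UNIV. c (index_nat j) (index_nat (k :: 'a dim_index)) * (?g (index_nat k) \<bullet> e (index_nat i)))"
      for i j :: "'a dim_index"
      using sum_index_nat[where 'a = 'a, of "\<lambda>k. c (index_nat j) k * (?g k \<bullet> e (index_nat i))"]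
      by (subst z[OF index_nat_less]) (simp add: inner_sum_left)
    then show ?thesis
      by (simp add: X_def R_def Y_def matrix_matrix_mult_def Finite_Cartesian_Product.vec_eq_iff)
  qed
  moreover have "det R = 1"
    by (subst det_lowerdiagonal) (auto simp: R_def c_def less_dim_index_def index_nat_inject)
  ultimately have "det X = det Y" by (simp add: det_mul)
  have "(det Y)\<^sup>2 = det (Y ** Finite_Cartesian_Product.transpose Y)"
    by (simp add: det_mul power2_eq_square)
  also have "Y ** Finite_Cartesian_Product.transpose Y = (\<chi> j k. ?g (index_nat j) \<bullet> ?g (index_nat k))"
  proof -
    have "(\<Sum>i\<in>UNIV. (?g j \<bullet> e (index_nat (i :: 'a dim_index))) * (?g k \<bullet> e (index_nat i))) = ?g j \<bullet> ?g k" for j k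
      using orthonormal_inner_expand[OF e, of "?g j" "?g k"]
        sum_index_nat[where 'a = 'a, of "\<lambda>i. (?g j \<bullet> e i) * (?g k \<bullet> e i)"] by simp
    then show ?thesis
      by (simp add: Y_def matrix_matrix_mult_def Finite_Cartesian_Product.transpose_def Finite_Cartesian_Product.vec_eq_iff)
  qed
  also have "det \<dots> = (\<Prod>j\<in>UNIV. ?g (index_nat (j :: 'a dim_index)) \<bullet> ?g (index_nat j))"
    by (subst det_diagonal) (auto simp: gram_schmidt_orthogonal index_nat_inject)
  also have "\<dots> = (\<Prod>j<DIM('a). norm (?g j))\<^sup>2"
    using prod_index_nat[where 'a = 'a, of "\<lambda>j. ?g j \<bullet> ?g j"]
    by (simp add: prod_power_distrib power2_norm_eq_inner)
  finally have "\<bar>det Y\<bar> = (\<Prod>j<DIM('a). norm (?g j))"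
    by (metis abs_of_nonneg norm_ge_zero power2_eq_iff_nonneg prod_nonneg real_sqrt_abs)
  \<comment> \<open>The matrix of a linear map has the images of the axes as columns, whereas
    \<open>X\<close> has them as rows.\<close>
  moreover have "matrix (coords e \<circ> lincomb z) = Finite_Cartesian_Product.transpose X"
  proof -
    have "lincomb z (axis j 1) = z (index_nat j)" for j
    proof -
      have "lincomb z (axis j 1) = (\<Sum>i\<in>UNIV. if i = j then z (index_nat j) else 0)"
        unfolding lincomb_def by (intro sum.cong) (auto simp: axis_def)
      then show ?thesis by simp
    qed
    then show ?thesis
      by (simp add: matrix_def X_def coords_def Finite_Cartesian_Product.transpose_def Finite_Cartesian_Product.vec_eq_iff)
  qed
  ultimately show ?thesis using \<open>det X = det Y\<close> by simp
qed

section \<open>The simplex, its thickening by a unit cube, and its volume\<close>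

lemma convex_hull_insert_0_image:
  fixes z :: "nat \<Rightarrow> 'a::euclidean_space"
  shows "convex hull (insert 0 (z ` {..<k})) =
    {\<Sum>i<k. u i *\<^sub>R z i | u. (\<forall>i<k. 0 \<le> u i) \<and> (\<Sum>i<k. u i) \<le> 1}" (is "?S = ?T")
proof
  show "?S \<subseteq> ?T"
  proof (rule hull_minimal)
    have "0 \<in> ?T" by (rule CollectI, rule exI[of _ "\<lambda>_. 0"]) simp
    moreover have "z i \<in> ?T" if "i < k" for i
    proof (rule CollectI, rule exI[of _ "\<lambda>j. if j = i then 1 else 0"], intro conjI)
      have "(\<Sum>j<k. (if j = i then 1 else 0) *\<^sub>R z j) = (\<Sum>j<k. if j = i then z i else 0)"
        by (intro sum.cong) auto
      then show "z i = (\<Sum>j<k. (if j = i then 1 else 0) *\<^sub>R z j)" using that by simp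
    qed (use that in auto)
    ultimately show "insert 0 (z ` {..<k}) \<subseteq> ?T" by blast
    show "convex ?T"
    proof (rule convexI)
      fix x y :: 'a and a b :: real
      assume "x \<in> ?T" "y \<in> ?T" and ab: "0 \<le> a" "0 \<le> b" "a + b = 1"
      then obtain u v where uv: "x = (\<Sum>i<k. u i *\<^sub>R z i)" "\<forall>i<k. 0 \<le> u i" "(\<Sum>i<k. u i) \<le> 1"
        "y = (\<Sum>i<k. v i *\<^sub>R z i)" "\<forall>i<k. 0 \<le> v i" "(\<Sum>i<k. v i) \<le> 1" by blast
      have "(\<Sum>i<k. a * u i + b * v i) = a * (\<Sum>i<k. u i) + b * (\<Sum>i<k. v i)"
        by (simp add: sum.distrib sum_distrib_left)
      also have "\<dots> \<le> a * 1 + b * 1"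
        using uv ab by (intro add_mono mult_left_mono) auto
      finally have "(\<Sum>i<k. a * u i + b * v i) \<le> 1" using ab by simp
      then show "a *\<^sub>R x + b *\<^sub>R y \<in> ?T"
        using uv ab
        by (intro CollectI exI[of _ "\<lambda>i. a * u i + b * v i"])
          (simp add: scaleR_sum_right sum.distrib algebra_simps)
    qed
  qed
  show "?T \<subseteq> ?S"
  proof
    fix x assume "x \<in> ?T"
    then obtain u where u: "x = (\<Sum>i<k. u i *\<^sub>R z i)" "\<forall>i<k. 0 \<le> u i" "(\<Sum>i<k. u i) \<le> 1" by blast
    \<comment> \<open>The weight missing to 1 goes to the origin, added as a vertex with index
      \<open>k\<close>.\<close>
    let ?u = "u(k := 1 - (\<Sum>i<k. u i))" and ?z = "z(k := 0)"
    have "(\<Sum>i<Suc k. ?u i *\<^sub>R ?z i) \<in> ?S"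
    proof (rule convex_sum)
      show "?z i \<in> ?S" if "i \<in> {..<Suc k}" for i
        using that by (intro hull_inc) auto
    qed (use u in auto)
    then show "x \<in> ?S" using u(1) by simp
  qed
qed

text \<open>Multiplying a set by a unit cube in the complementary directions turns \<open>k\<close>-dimensional
  into \<open>d\<close>-dimensional Lebesgue measure.\<close>

lemma emeasure_lborel_cylinder:
  fixes e :: "nat \<Rightarrow> 'a::euclidean_space"
  assumes e: "orthonormal DIM('a) e" and k: "k \<le> DIM('a)"
    and A [measurable]: "A \<in> sets (\<Pi>\<^sub>M i\<in>{..<k}. (lborel :: real measure))"
  shows "emeasure lborel {v. (\<lambda>i\<in>{..<k}. v \<bullet> e i) \<in> A \<and> (\<forall>i\<in>{k..<DIM('a)}. v \<bullet> e i \<in> {0..1})} =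
    emeasure (\<Pi>\<^sub>M i\<in>{..<k}. lborel) A"
proof -
  interpret product_sigma_finite "\<lambda>_. lborel :: real measure" by standard
  let ?f = "\<lambda>v. \<lambda>i\<in>{..<k}. v \<bullet> e i"
  let ?C = "{v. \<forall>i\<in>{k..<DIM('a)}. v \<bullet> e i \<in> {0..1}}"
  let ?N = "\<Pi>\<^sub>M i\<in>{..<k}. (lborel :: real measure)"
  \<comment> \<open>Lebesgue measure on the slab, projected to the first \<open>k\<close>
    coordinates. The claim follows once this is recognized as the product measure, which rectangles
    decide.\<close>
  define P where "P = distr (density lborel (indicator ?C)) ?N ?f"
  have f [measurable]: "?f \<in> lborel \<rightarrow>\<^sub>M ?N"
    by (intro measurable_restrict) simp
  have C [measurable]: "?C \<in> sets borel" by measurable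
  have P: "emeasure P X = emeasure lborel (?C \<inter> ?f -` X)" if X [measurable]: "X \<in> sets ?N" for X
  proof -
    have fX: "?f -` X \<in> sets borel" using measurable_sets[OF f X] by simp
    have "emeasure P X = (\<integral>\<^sup>+v. indicator ?C v * indicator (?f -` X) v \<partial>lborel)"
      unfolding P_def using fX by (subst emeasure_distr) (auto simp: emeasure_density)
    also have "\<dots> = (\<integral>\<^sup>+v. indicator (?C \<inter> ?f -` X) v \<partial>lborel)"
      by (simp add: indicator_inter_arith)
    finally show ?thesis using fX by simp
  qed
  have "P = ?N"
  proof (rule PiM_eqI)
    fix X :: "nat \<Rightarrow> real set"
    assume X: "\<And>i. i \<in> {..<k} \<Longrightarrow> X i \<in> sets lborel"
    \<comment> \<open>The remaining sides are unit intervals, so each contributes a factor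
      1.\<close>
    define Y where "Y i = (if i < k then X i else {0..1})" for i
    have Y: "Y i \<in> sets borel" for i using X by (auto simp: Y_def)
    have "emeasure P (Pi\<^sub>E {..<k} X) = emeasure lborel (?C \<inter> ?f -` (Pi\<^sub>E {..<k} X))"
      by (intro P sets_PiM_I_finite) (use X in auto)
    also have "?C \<inter> ?f -` (Pi\<^sub>E {..<k} X) = {v. \<forall>i<DIM('a). v \<bullet> e i \<in> Y i}"
      using k by (auto simp: Y_def PiE_iff split: if_splits)
    also have "emeasure lborel \<dots> = (\<integral>\<^sup>+v. indicator {v. \<forall>i<DIM('a). v \<bullet> e i \<in> Y i} v \<partial>lborel)"
    proof (rule nn_integral_indicator[symmetric])
      show "{v. \<forall>i<DIM('a). v \<bullet> e i \<in> Y i} \<in> sets lborel"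
        using Y by measurable
    qed
    also have "\<dots> = (\<integral>\<^sup>+v. (\<Prod>i<DIM('a). indicator (Y i) (v \<bullet> e i)) \<partial>lborel)"
      by (intro nn_integral_cong) (auto simp: indicator_def prod_zero_iff)
    also have "\<dots> = (\<Prod>i<DIM('a). \<integral>\<^sup>+t. indicator (Y i) t \<partial>lborel)"
      using Y by (intro nn_integral_orthonormal_prod[OF e]) auto
    also have "\<dots> = (\<Prod>i<DIM('a). if i < k then emeasure lborel (X i) else 1)"
      using X by (intro prod.cong) (auto simp: Y_def)
    also have "\<dots> = (\<Prod>i<k. emeasure lborel (X i))"
      using k by (intro prod.mono_neutral_cong_right) auto
    finally show "emeasure P (Pi\<^sub>E {..<k} X) = (\<Prod>i<k. emeasure lborel (X i))" .
  qed (auto simp: P_def)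
  then have "emeasure ?N A = emeasure lborel (?C \<inter> ?f -` A)"
    using P[OF A] by simp
  then show ?thesis by (simp add: Collect_conj_eq Int_commute vimage_def)
qed

text \<open>Each appended \<open>e i\<close> is already orthogonal to all earlier vectors, so
  nothing is subtracted from it. The padding therefore adds only factors 1 to the product of
  norms.\<close>

lemma gram_schmidt_extend_orthonormal:
  fixes e z :: "nat \<Rightarrow> 'a::euclidean_space"
  assumes e: "orthonormal n e" and z: "\<And>i j. i < k \<Longrightarrow> k \<le> j \<Longrightarrow> j < n \<Longrightarrow> z i \<bullet> e j = 0" and "i < n"
  shows "gram_schmidt (\<lambda>i. if i < k then z i else e i) i = (if i < k then gram_schmidt z i else e i)"
  using \<open>i < n\<close>
proof (induction i rule: less_induct)
  case (less i)
  let ?z = "\<lambda>i. if i < k then z i else e i"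
  have g_e: "gram_schmidt z l \<bullet> e j = 0" if "l < k" "k \<le> j" "j < n" for l j
    using \<open>l < k\<close>
  proof (induction l rule: less_induct)
    case (less l)
    then show ?case
      using z[of l j] that by (simp add: gram_schmidt.simps[of z l] inner_diff_left inner_sum_left)
  qed
  show ?case
  proof (cases "i < k")
    case True
    then show ?thesis by (simp add: gram_schmidt_cong[of i ?z z])
  next
    case False
    have "e i \<bullet> gram_schmidt ?z j = 0" if "j < i" for j
      using less.IH[OF that] less.prems that False g_e[of j i] orthonormalD[OF e, of i j]
      by (auto simp: inner_commute)
    then show ?thesis using False by (simp add: gram_schmidt.simps[of ?z i])
  qed
qed

text \<open>The right-hand side involves neither \<open>p\<close> nor \<open>e\<close>, which is
  what makes the choice in \<open>kvolume\<close> harmless. The cylinder over the coordinate set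
  \<open>?A\<close> is, up to translation by \<open>p\<close>, the image \<open>T\<close> of simplex
  times cube \<open>Q\<close> under the edge vectors padded with the frame. The determinant yields
  the product of norms, and \<open>Q\<close> the factor \<open>1 / fact k\<close>.\<close>

lemma measure_simplex_coordinates:
  fixes e z :: "nat \<Rightarrow> 'a::euclidean_space" and p :: 'a
  assumes e: "orthonormal k e"
    and sub: "convex hull (insert 0 (z ` {..<k})) \<subseteq> range (\<lambda>c. p + (\<Sum>i<k. c i *\<^sub>R e i))"
  shows "measure (\<Pi>\<^sub>M i\<in>{..<k}. (lborel :: real measure))
      {c \<in> (\<Pi>\<^sub>E i\<in>{..<k}. (UNIV :: real set)). p + (\<Sum>i<k. c i *\<^sub>R e i) \<in> convex hull (insert 0 (z ` {..<k}))} =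
    (\<Prod>i<k. norm (gram_schmidt z i)) / fact k"
    (is "measure ?N ?A = _")
proof -
  let ?S = "convex hull (insert 0 (z ` {..<k}))"
  have k: "k \<le> DIM('a)" by (rule orthonormal_le_DIM[OF e])
  obtain e' where e': "orthonormal DIM('a) e'" and e'_eq: "\<And>i. i < k \<Longrightarrow> e' i = e i"
    using orthonormal_extend[OF e] by blast
  have span: "\<exists>c. x = p + (\<Sum>i<k. c i *\<^sub>R e' i)" if "x \<in> ?S" for x
    using sub that e'_eq by force
  have diff: "(x - p) \<bullet> e' j = 0" if "x \<in> ?S" "k \<le> j" "j < DIM('a)" for x j
    using span[OF that(1)] that orthonormalD[OF e', of _ j] k by (auto simp: inner_sum_left)
  \<comment> \<open>The origin is a vertex, so the affine span is a linear subspace and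
    \<open>p\<close> lies in it.\<close>
  have p: "p \<bullet> e' j = 0" if "k \<le> j" "j < DIM('a)" for j
    using diff[of 0 j] that by (simp add: hull_inc)
  have S_orth: "x \<bullet> e' j = 0" if "x \<in> ?S" "k \<le> j" "j < DIM('a)" for x j
    using diff[OF that] p[OF that(2,3)] by (simp add: inner_diff_left)
  have z_orth: "z i \<bullet> e' j = 0" if "i < k" "k \<le> j" "j < DIM('a)" for i j
    using S_orth[of "z i" j] that by (simp add: hull_inc)
  have split: "(\<Sum>i<DIM('a). f i) = (\<Sum>i<k. f i) + (\<Sum>i\<in>{k..<DIM('a)}. f i)" for f :: "nat \<Rightarrow> 'a"
    using sum.union_disjoint[of "{..<k}" "{k..<DIM('a)}" f] k
    by (simp add: ivl_disj_un ivl_disj_int)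
  have S_closed: "closed ?S"
    by (intro compact_imp_closed compact_convex_hull finite_imp_compact) simp
  have A_eq: "?A = (\<lambda>c. p + (\<Sum>i<k. c i *\<^sub>R e i)) -` ?S \<inter> space ?N"
    by (auto simp: space_PiM)
  have A [measurable]: "?A \<in> sets ?N"
    unfolding A_eq using S_closed by measurable
  \<comment> \<open>The standard simplex in the first \<open>k\<close> coordinates times the unit
    cube in the others; \<open>D\<close> below is the simplex factor alone, as a set of functions on
    \<open>{..<k}\<close>.\<close>
  define Q :: "(real ^ 'a dim_index) set" where
    "Q = {w. (\<forall>i. 0 \<le> w $ i) \<and> (\<forall>i. w $ i \<le> 1) \<and> (\<Sum>i | index_nat i < k. w $ i) \<le> 1}"
  define D where "D = {x::nat \<Rightarrow> real. (\<forall>i\<in>{..<k}. 0 \<le> x i) \<and> sum x {..<k} \<le> 1} \<inter> space ?N"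
  let ?z = "\<lambda>i. if i < k then z i else e' i"
  have sum_small: "(\<Sum>i | index_nat (i :: 'a dim_index) < k. f (index_nat i)) = (\<Sum>i<k. f i)"
    for f :: "nat \<Rightarrow> real"
  proof (rule sum.reindex_bij_betw)
    show "bij_betw index_nat {i :: 'a dim_index. index_nat i < k} {..<k}"
      using k nat_index_inverse[where 'a = 'a]
      by (intro bij_betw_byWitness[where f' = nat_index]) (auto simp: index_nat_inverse)
  qed
  have Q_closed: "closed Q"
    unfolding Q_def by (intro closed_Collect_conj closed_Collect_all closed_Collect_le continuous_intros)
  have Q_bounded: "bounded Q"
  proof (rule bounded_subset[OF bounded_cbox])
    show "Q \<subseteq> cbox 0 (\<chi> i. 1)" by (auto simp: Q_def mem_box_cart)
  qed
  then have Q_compact: "compact Q" using Q_closed by (simp add: compact_eq_bounded_closed)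
  have D: "emeasure ?N D = ennreal (1 / fact k)"
    unfolding D_def by (subst emeasure_std_simplex_aux) simp_all
  \<comment> \<open>A nonmeasurable set would get the default measure 0, but \<open>D\<close> has
    positive measure.\<close>
  have D_meas: "D \<in> sets ?N"
  proof (rule ccontr)
    assume "D \<notin> sets ?N"
    then show False using D by (simp add: emeasure_notin_sets)
  qed
  have vimage_meas: "emeasure lborel (lincomb e' -` X) = emeasure lborel X" if "X \<in> sets borel" for X
    using that measurable_linear[OF linear_lincomb, of e']
    by (subst lborel_distr_lincomb[OF e', symmetric], subst emeasure_distr) auto
  \<comment> \<open>\<open>Q\<close> is itself a cylinder, namely over \<open>D\<close>, when read
    in the frame \<open>e'\<close>.\<close>
  have "emeasure lborel Q = ennreal (1 / fact k)"
  proof -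
    let ?C = "{v. (\<lambda>i\<in>{..<k}. v \<bullet> e' i) \<in> D \<and> (\<forall>i\<in>{k..<DIM('a)}. v \<bullet> e' i \<in> {0..1})}"
    have "w \<in> lincomb e' -` ?C \<longleftrightarrow> w \<in> Q" for w
    proof -
      have w: "lincomb e' w \<bullet> e' i = w $ nat_index i" "index_nat (nat_index i :: 'a dim_index) = i" if "i < DIM('a)" for i
        using lincomb_inner[OF e', of w "nat_index i"] nat_index_inverse[of i, where 'a = 'a] that by auto
      have "w \<in> lincomb e' -` ?C \<longleftrightarrow>
          (\<forall>i<k. 0 \<le> lincomb e' w \<bullet> e' i) \<and> (\<Sum>i<k. lincomb e' w \<bullet> e' i) \<le> 1 \<and>
          (\<forall>i<DIM('a). k \<le> i \<longrightarrow> 0 \<le> lincomb e' w \<bullet> e' i \<and> lincomb e' w \<bullet> e' i \<le> 1)"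
        by (auto simp: D_def space_PiM)
      also have "\<dots> \<longleftrightarrow> (\<forall>i<DIM('a). 0 \<le> lincomb e' w \<bullet> e' i) \<and> (\<forall>i<DIM('a). lincomb e' w \<bullet> e' i \<le> 1) \<and>
          (\<Sum>i<k. lincomb e' w \<bullet> e' i) \<le> 1"
        (is "?L \<longleftrightarrow> ?R")
      proof
        assume ?L
        have "lincomb e' w \<bullet> e' i \<le> 1" if "i < k" for i
          using member_le_sum[of i "{..<k}" "\<lambda>i. lincomb e' w \<bullet> e' i"] \<open>?L\<close> that by auto
        then show ?R using \<open>?L\<close> by (metis not_less)
      qed (use k in auto)
      also have "\<dots> \<longleftrightarrow> w \<in> Q"
      proof -
        have all: "(\<forall>i<DIM('a). P (lincomb e' w \<bullet> e' i)) \<longleftrightarrow> (\<forall>i. P (w $ i))" for P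
          using w(1) lincomb_inner[OF e', of w] index_nat_less by metis
        show ?thesis
          unfolding Q_def all[of "\<lambda>t. 0 \<le> t"] all[of "\<lambda>t. t \<le> 1"]
          using sum_small[of "\<lambda>i. lincomb e' w \<bullet> e' i"] by (simp add: lincomb_inner[OF e'])
      qed
      finally show ?thesis .
    qed
    then have C_Q: "lincomb e' -` ?C = Q" by blast
    have C_meas: "?C \<in> sets borel"
    proof -
      have "(\<lambda>v. \<lambda>i\<in>{..<k}. v \<bullet> e' i) -` D \<in> sets borel"
        using measurable_sets[OF _ D_meas, of "\<lambda>v. \<lambda>i\<in>{..<k}. v \<bullet> e' i" borel]
        by (simp add: measurable_restrict)
      moreover have "{v. \<forall>i\<in>{k..<DIM('a)}. v \<bullet> e' i \<in> {0..1}} \<in> sets borel" by measurable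
      ultimately show ?thesis by (simp add: vimage_def Collect_conj_eq sets.Int)
    qed
    have "emeasure lborel Q = emeasure lborel ?C" using vimage_meas[OF C_meas] unfolding C_Q .
    also have "\<dots> = emeasure ?N D" by (rule emeasure_lborel_cylinder[OF e' k D_meas])
    finally show ?thesis using D by simp
  qed
  then have Q: "measure lebesgue Q = 1 / fact k" "Q \<in> lmeasurable"
    using lmeasurable_compact[OF Q_compact] borel_compact[OF Q_compact] by (auto simp: measure_def)
  define T where "T = lincomb ?z ` Q"
  have "compact T"
    unfolding T_def using Q_compact linear_lincomb
    by (intro compact_continuous_image linear_continuous_on) (simp_all add: linear_conv_bounded_linear)
  then have T: "T \<in> sets borel" by (simp add: borel_compact)
  \<comment> \<open>In the coordinates of \<open>e'\<close>, \<open>T\<close> becomes the image of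
    \<open>Q\<close> under an endomorphism of the coordinate space, to which the determinant formula
    applies.\<close>
  have "lincomb e' w = x \<longleftrightarrow> w = coords e' x" for w x
    using lincomb_coords[OF e', of x] coords_lincomb[OF e', of w] by auto
  then have vimage_T: "lincomb e' -` T = (coords e' \<circ> lincomb ?z) ` Q"
    unfolding T_def by (auto simp: image_iff)
  have lin: "linear (coords e' \<circ> lincomb ?z)"
    by (intro linear_compose linear_lincomb linear_coords)
  have "measure lebesgue (lincomb e' -` T) = (\<Prod>i<DIM('a). norm (gram_schmidt ?z i)) * (1 / fact k)"
    using measure_linear_image[OF lin Q(2)] Q(1)
      abs_det_eq_prod_gram_schmidt[OF e', of ?z] unfolding vimage_T by simp_all
  moreover have "(\<Prod>i<DIM('a). norm (gram_schmidt ?z i)) = (\<Prod>i<k. norm (gram_schmidt z i))"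
  proof (rule prod.mono_neutral_cong_right)
    have "norm (e' i) = 1" if "i < DIM('a)" for i
      using orthonormalD[OF e' that that] by (simp add: norm_eq_1)
    then show "\<forall>i\<in>{..<DIM('a)} - {..<k}. norm (gram_schmidt ?z i) = 1"
      using gram_schmidt_extend_orthonormal[OF e' z_orth] by auto
    show "norm (gram_schmidt ?z i) = norm (gram_schmidt z i)" if "i \<in> {..<k}" for i
      using gram_schmidt_cong[of i ?z z] that by simp
  qed (use k in auto)
  moreover have "lincomb e' -` T \<in> sets borel"
    using measurable_sets[OF measurable_linear[OF linear_lincomb] T, of e'] by simp
  ultimately have measure_T: "measure lborel T = (\<Prod>i<k. norm (gram_schmidt z i)) / fact k"
    using vimage_meas[OF T] by (simp add: measure_def)
  let ?C = "{v. (\<lambda>i\<in>{..<k}. v \<bullet> e' i) \<in> ?A \<and> (\<forall>i\<in>{k..<DIM('a)}. v \<bullet> e' i \<in> {0..1})}"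
  have lincomb_z: "lincomb ?z w = (\<Sum>i<k. w $ nat_index i *\<^sub>R z i) + (\<Sum>i\<in>{k..<DIM('a)}. w $ nat_index i *\<^sub>R e' i)" for w
  proof -
    have "lincomb ?z w = (\<Sum>i<DIM('a). w $ nat_index i *\<^sub>R ?z i)"
      unfolding lincomb_def
      using sum_index_nat[where 'a = 'a, of "\<lambda>i. w $ nat_index i *\<^sub>R ?z i"] by (simp add: index_nat_inverse)
    then show ?thesis by (simp add: split)
  qed
  \<comment> \<open>A point of the cylinder corresponds to the vector \<open>w\<close> with the
    simplex weights in the first \<open>k\<close> places and the cube coordinates of
    \<open>v\<close> in the rest.\<close>
  have "v \<in> ?C \<longleftrightarrow> p + v \<in> T" for v
  proof
    assume v: "v \<in> ?C"
    then have "p + (\<Sum>i<k. (v \<bullet> e' i) *\<^sub>R e' i) \<in> ?S"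
      by (simp add: e'_eq)
    then obtain u where u: "p + (\<Sum>i<k. (v \<bullet> e' i) *\<^sub>R e' i) = (\<Sum>i<k. u i *\<^sub>R z i)"
      "\<forall>i<k. 0 \<le> u i" "(\<Sum>i<k. u i) \<le> 1"
      unfolding convex_hull_insert_0_image by blast
    define w :: "real ^ 'a dim_index" where
      "w = (\<chi> i. if index_nat i < k then u (index_nat i) else v \<bullet> e' (index_nat i))"
    have w: "w $ nat_index i = (if i < k then u i else v \<bullet> e' i)" if "i < DIM('a)" for i
      using nat_index_inverse[of i, where 'a = 'a] that by (simp add: w_def)
    have "lincomb ?z w = p + (\<Sum>i<DIM('a). (v \<bullet> e' i) *\<^sub>R e' i)"
      unfolding lincomb_z split using u(1) k by (simp add: w add.assoc[symmetric])
    then have "lincomb ?z w = p + v" by (simp add: orthonormal_expand[OF e'])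
    moreover have "w \<in> Q"
    proof -
      have "u i \<le> 1" if "i < k" for i
        using member_le_sum[of i "{..<k}" u] u that by auto
      moreover have "(\<Sum>i | index_nat i < k. w $ i) = (\<Sum>i<k. u i)"
        using sum_small[of u] by (simp add: w_def)
      ultimately show ?thesis
        using u v index_nat_less[where 'a = 'a] by (auto simp: Q_def w_def not_less)
    qed
    ultimately show "p + v \<in> T" unfolding T_def by (metis image_eqI)
  next
    assume "p + v \<in> T"
    then obtain w where w: "w \<in> Q" "p + v = lincomb ?z w" unfolding T_def by blast
    have ve: "v \<bullet> e' j = w $ nat_index j" if "j \<in> {k..<DIM('a)}" for j
    proof -
      have "v \<bullet> e' j = (p + v) \<bullet> e' j" using p that by (simp add: inner_add_left)
      also have "\<dots> = (\<Sum>i<k. (w $ nat_index i *\<^sub>R z i) \<bullet> e' j) + (\<Sum>i\<in>{k..<DIM('a)}. (w $ nat_index i *\<^sub>R e' i) \<bullet> e' j)"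
        unfolding w(2) lincomb_z inner_add_left inner_sum_left ..
      also have "(\<Sum>i<k. (w $ nat_index i *\<^sub>R z i) \<bullet> e' j) = 0"
        using z_orth that by simp
      also have "(\<Sum>i\<in>{k..<DIM('a)}. (w $ nat_index i *\<^sub>R e' i) \<bullet> e' j) =
          (\<Sum>i\<in>{k..<DIM('a)}. if i = j then w $ nat_index j else 0)"
        using orthonormalD[OF e', of _ j] that by (intro sum.cong) auto
      finally show ?thesis using that by simp
    qed
    have "p + (\<Sum>i<k. (v \<bullet> e' i) *\<^sub>R e' i) = p + v - (\<Sum>i\<in>{k..<DIM('a)}. (v \<bullet> e' i) *\<^sub>R e' i)"
      using orthonormal_expand[OF e', of v, unfolded split] by (simp add: eq_diff_eq add.assoc)
    also have "\<dots> = (\<Sum>i<k. w $ nat_index i *\<^sub>R z i)"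
      unfolding w(2) lincomb_z using ve by simp
    finally have "p + (\<Sum>i<k. (v \<bullet> e' i) *\<^sub>R e' i) = (\<Sum>i<k. w $ nat_index i *\<^sub>R z i)" .
    moreover have "(\<Sum>i<k. w $ nat_index i) \<le> 1" "\<forall>i<k. 0 \<le> w $ nat_index i"
      using w(1) sum_small[of "\<lambda>i. w $ nat_index i"] by (auto simp: Q_def index_nat_inverse)
    ultimately have "p + (\<Sum>i<k. (v \<bullet> e' i) *\<^sub>R e' i) \<in> ?S"
      unfolding convex_hull_insert_0_image by (intro CollectI exI[of _ "\<lambda>i. w $ nat_index i"]) simp
    then show "v \<in> ?C"
      using ve w(1) by (simp add: e'_eq Q_def)
  qed
  then have "?C = (+) p -` T" by auto
  then have "emeasure lborel ?C = emeasure lborel T"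
    using T by (subst (2) lborel_distr_plus[of p, symmetric], subst emeasure_distr) auto
  then have "emeasure ?N ?A = emeasure lborel T"
    using emeasure_lborel_cylinder[OF e' k A] by simp
  then show ?thesis using measure_T by (simp add: measure_def)
qed

lemma component_borel_measurable:
  "i \<in> I \<Longrightarrow> (\<lambda>x. x i) \<in> borel_measurable (\<Pi>\<^sub>M i\<in>I. (lborel :: 'a::euclidean_space measure))"
  using measurable_component_singleton[of i I "\<lambda>_. lborel :: 'a measure"] by simp

text \<open>An orthonormal basis of the span, extended to a full frame. The span may have dimension
  below \<open>k\<close>, so only the directions from \<open>k\<close> on are sure to be orthogonal
  to it.\<close>

lemma ex_orthonormal_flag:
  fixes z :: "nat \<Rightarrow> 'a::euclidean_space"
  obtains e where "orthonormal DIM('a) e"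
    "\<And>x j. x \<in> span (z ` {..<k}) \<Longrightarrow> k \<le> j \<Longrightarrow> j < DIM('a) \<Longrightarrow> x \<bullet> e j = 0"
proof -
  let ?V = "span (z ` {..<k})"
  obtain B where B: "B \<subseteq> ?V" "pairwise orthogonal B" "\<And>x. x \<in> B \<Longrightarrow> norm x = 1"
    "independent B" "card B = dim ?V" "span B = ?V"
    by (rule orthonormal_basis_subspace[OF subspace_span[of "z ` {..<k}"]]) (rule that)
  have "finite B" using B(4) independent_imp_finite by blast
  then obtain f where f: "bij_betw f {..<card B} B"
    using ex_bij_betw_nat_finite[of B] by (auto simp: atLeast0LessThan)
  have "card B \<le> k"
    using B(5) dim_le_card'[of "z ` {..<k}"] card_image_le[of "{..<k}" z] by (simp add: dim_span)
  have "f i \<bullet> f j = (if i = j then 1 else 0)" if "i < card B" "j < card B" for i j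
  proof (cases "i = j")
    case True
    then show ?thesis using B(3)[of "f i"] bij_betwE[OF f] that by (simp add: norm_eq_1)
  next
    case False
    then have "f i \<noteq> f j" using inj_onD[OF bij_betw_imp_inj_on[OF f], of i j] that by auto
    then show ?thesis
      using B(2) bij_betwE[OF f] that False by (auto simp: pairwise_def Linear_Algebra.orthogonal_def)
  qed
  then have "orthonormal (card B) f" by (simp add: orthonormal_def)
  then obtain e where e: "orthonormal DIM('a) e" "\<And>i. i < card B \<Longrightarrow> e i = f i"
    using orthonormal_extend by blast
  have "x \<bullet> e j = 0" if "x \<in> ?V" and j: "k \<le> j" "j < DIM('a)" for x j
  proof -
    have *: "orthogonal (e j) b" if "b \<in> B" for b
    proof -
      have "b \<in> f ` {..<card B}" using that f by (simp add: bij_betw_imp_surj_on)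
      then obtain i where "i < card B" "b = e i" using e(2) by auto
      then show ?thesis
        using orthonormalD[OF e(1), of j i] j \<open>card B \<le> k\<close> by (simp add: Linear_Algebra.orthogonal_def)
    qed
    have "x \<in> span B" using that B(6) by simp
    from orthogonal_to_span[OF this *] have "orthogonal (e j) x" .
    then show ?thesis by (simp add: Linear_Algebra.orthogonal_def inner_commute)
  qed
  with e(1) show thesis by (rule that)
qed

text \<open>The flag frame with origin 0 shows that the choice ranges over a nonempty set, and
  \<open>measure_simplex_coordinates\<close> that all its elements are equal.\<close>

lemma kvolume_simplex:
  fixes z :: "nat \<Rightarrow> 'a::euclidean_space"
  assumes k: "k \<le> DIM('a)"
  shows "kvolume k (convex hull (insert 0 (z ` {..<k}))) = (\<Prod>i<k. norm (gram_schmidt z i)) / fact k"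
proof -
  let ?S = "convex hull (insert 0 (z ` {..<k}))"
  obtain e where e: "orthonormal DIM('a) e"
    and orth: "\<And>x j. x \<in> span (z ` {..<k}) \<Longrightarrow> k \<le> j \<Longrightarrow> j < DIM('a) \<Longrightarrow> x \<bullet> e j = 0"
    by (rule ex_orthonormal_flag[of z k]) (rule that)
  have sub: "?S \<subseteq> range (\<lambda>c. 0 + (\<Sum>i<k. c i *\<^sub>R e i))"
  proof
    fix x assume "x \<in> ?S"
    then have x: "x \<in> span (z ` {..<k})"
      using convex_hull_subset_span[of "insert 0 (z ` {..<k})"] by (auto simp: span_insert_0)
    have "x = (\<Sum>i<DIM('a). (x \<bullet> e i) *\<^sub>R e i)"
      by (simp add: orthonormal_expand[OF e])
    also have "\<dots> = (\<Sum>i<k. (x \<bullet> e i) *\<^sub>R e i)"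
      using orth[OF x] k by (intro sum.mono_neutral_right) auto
    finally show "x \<in> range (\<lambda>c. 0 + (\<Sum>i<k. c i *\<^sub>R e i))" by auto
  qed
  show ?thesis
    unfolding kvolume_def
  proof (rule some_equality, goal_cases)
    case 1
    show ?case
      using measure_simplex_coordinates[OF orthonormal_mono[OF e k] sub] sub orthonormal_mono[OF e k]
      unfolding orthonormal_def by (intro exI[of _ "0::'a"] exI[of _ e]) auto
  next
    case (2 v)
    then obtain p e where "orthonormal k e" "?S \<subseteq> range (\<lambda>c. p + (\<Sum>i<k. c i *\<^sub>R e i))"
      and v: "v = measure (\<Pi>\<^sub>M i\<in>{..<k}. (lborel :: real measure))
           {c \<in> (\<Pi>\<^sub>E i\<in>{..<k}. (UNIV :: real set)). p + (\<Sum>i<k. c i *\<^sub>R e i) \<in> ?S}"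
      unfolding orthonormal_def by blast
    then show ?case using measure_simplex_coordinates by blast
  qed
qed

text \<open>The base of the power in \<open>simplex_vol_powr\<close> for the vertices 0,
  \<open>x 1\<close>, ..., \<open>x k\<close>. The successor converts their numbering from 1 into
  the numbering from 0 of \<open>gram_schmidt\<close>.\<close>

definition simplex_volume :: "nat \<Rightarrow> (nat \<Rightarrow> 'a::euclidean_space) \<Rightarrow> real" where
  "simplex_volume k x = (if k \<le> DIM('a) then (\<Prod>i<k. norm (gram_schmidt (\<lambda>i. x (Suc i)) i)) / fact k else 1)"

lemma simplex_vol_powr_eq:
  fixes x :: "nat \<Rightarrow> 'a::euclidean_space"
  shows "simplex_vol_powr 1 \<alpha> (0 # map x [1..<k + 1]) =
    (if (\<forall>i\<in>{1..k}. norm (x i) \<le> 1) \<and> (\<forall>i\<in>{1..k}. \<forall>j\<in>{1..k}. norm (x i - x j) \<le> 1)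
     then simplex_volume k x powr \<alpha> else 0)"
proof -
  have set: "set (0 # map x [1..<k + 1]) = insert 0 (x ` {1..k})"
    by (auto simp: atLeastLessThanSuc_atLeastAtMost simp del: upt_Suc)
  also have "\<dots> = insert 0 (x ` Suc ` {..<k})"
    by (simp add: image_Suc_lessThan)
  also have "\<dots> = insert 0 ((\<lambda>i. x (Suc i)) ` {..<k})" by (simp add: image_image)
  finally have *: "convex hull (set (0 # map x [1..<k + 1])) = convex hull (insert 0 ((\<lambda>i. x (Suc i)) ` {..<k}))"
    by simp
  have "(\<forall>y\<in>set (0 # map x [1..<k + 1]). \<forall>y'\<in>set (0 # map x [1..<k + 1]). norm (y - y') \<le> 1) \<longleftrightarrow>
    (\<forall>i\<in>{1..k}. norm (x i) \<le> 1) \<and> (\<forall>i\<in>{1..k}. \<forall>j\<in>{1..k}. norm (x i - x j) \<le> 1)"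
    unfolding set by auto
  moreover have "length (0 # map x [1..<k + 1]) - 1 = k" by simp
  ultimately show ?thesis
    unfolding simplex_vol_powr_def * by (simp only: simplex_volume_def kvolume_simplex cong: if_cong)
qed

lemma simplex_vol_powr_nonneg: "simplex_vol_powr s \<alpha> xs \<ge> 0"
  by (simp add: simplex_vol_powr_def)

lemma simplex_volume_measurable [measurable]:
  "simplex_volume k \<in> borel_measurable (\<Pi>\<^sub>M i\<in>{1..k}. (lborel :: 'a::euclidean_space measure))"
proof -
  have [measurable]: "(\<lambda>x. gram_schmidt (\<lambda>i. x (Suc i)) i) \<in> borel_measurable (\<Pi>\<^sub>M i\<in>{1..k}. (lborel :: 'a measure))"
    if "i \<in> {..<k}" for i
  proof (rule gram_schmidt_measurable)
    fix j assume "j \<le> i"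
    then show "(\<lambda>x. x (Suc j)) \<in> borel_measurable (\<Pi>\<^sub>M i\<in>{1..k}. (lborel :: 'a measure))"
      using that by (intro component_borel_measurable) auto
  qed
  show ?thesis unfolding simplex_volume_def[abs_def] by measurable
qed

lemma simplex_vol_powr_measurable [measurable]:
  "(\<lambda>x. simplex_vol_powr 1 \<alpha> (0 # map x [1..<k + 1])) \<in> borel_measurable (\<Pi>\<^sub>M i\<in>{1..k}. (lborel :: 'a::euclidean_space measure))"
proof -
  have [measurable]: "(\<lambda>x. x i) \<in> borel_measurable (\<Pi>\<^sub>M i\<in>{1..k}. (lborel :: 'a measure))" if "i \<in> {1..k}" for i
    using that by (rule component_borel_measurable)
  show ?thesis unfolding simplex_vol_powr_eq by measurable
qed

section \<open>Integrability of powers of the volume\<close>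

lemma nn_integral_inverse_powr_Icc_finite:
  assumes "0 < \<gamma>" "\<gamma> < 1"
  shows "(\<integral>\<^sup>+t. indicator {-1..1} t * inverse (ennreal (\<bar>t\<bar> powr \<gamma>)) \<partial>lborel) < \<infinity>"
proof -
  define h where "h t = indicator {0..1} t * inverse (ennreal (t powr \<gamma>))" for t :: real
  have [measurable]: "h \<in> borel_measurable borel" unfolding h_def by measurable
  have "((\<lambda>t. t powr (- \<gamma>)) has_integral (1 powr (- \<gamma> + 1) / (- \<gamma> + 1))) {0..1::real}"
    by (rule has_integral_powr_from_0) (use assms in auto)
  then have "(\<integral>\<^sup>+t. ennreal (t powr (- \<gamma>)) * indicator {0..1} t \<partial>lborel) = ennreal (1 powr (- \<gamma> + 1) / (- \<gamma> + 1))"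
    by (intro nn_integral_has_integral_lebesgue') auto
  \<comment> \<open>The integrands differ at 0, where the inverse is infinite but the real power is
    0.\<close>
  moreover have "(\<integral>\<^sup>+t. h t \<partial>lborel) = (\<integral>\<^sup>+t. ennreal (t powr (- \<gamma>)) * indicator {0..1} t \<partial>lborel)"
  proof (rule nn_integral_cong_AE)
    show "AE t in lborel. h t = ennreal (t powr (- \<gamma>)) * indicator {0..1} t"
      using AE_lborel_singleton[of "0::real"]
    proof eventually_elim
      case (elim t)
      then show ?case by (auto simp: h_def indicator_def inverse_ennreal powr_minus)
    qed
  qed
  ultimately have h: "(\<integral>\<^sup>+t. h t \<partial>lborel) < \<infinity>" by simp
  have "(\<integral>\<^sup>+t. indicator {-1..1} t * inverse (ennreal (\<bar>t\<bar> powr \<gamma>)) \<partial>lborel) \<le> (\<integral>\<^sup>+t. h t + h (- t) \<partial>lborel)"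
    by (intro nn_integral_mono) (auto simp: h_def indicator_def abs_if)
  also have "\<dots> = (\<integral>\<^sup>+t. h t \<partial>lborel) + (\<integral>\<^sup>+t. h (- t) \<partial>lborel)"
    by (intro nn_integral_add) auto
  also have "(\<integral>\<^sup>+t. h (- t) \<partial>lborel) = (\<integral>\<^sup>+t. h t \<partial>lborel)"
    by (subst (2) lborel_distr_uminus[symmetric], subst nn_integral_distr) auto
  also have "(\<integral>\<^sup>+t. h t \<partial>lborel) + (\<integral>\<^sup>+t. h t \<partial>lborel) < \<infinity>"
    using h by (simp add: less_top)
  finally show ?thesis .
qed

text \<open>Zero factors are allowed: inverting a product could fail only for 0 times infinity, and
  the factors are finite.\<close>

lemma inverse_ennreal_prod:
  "(\<And>i. i \<in> I \<Longrightarrow> 0 \<le> f i) \<Longrightarrow> inverse (ennreal (\<Prod>i\<in>I. f i)) = (\<Prod>i\<in>I. inverse (ennreal (f i)))"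
  by (induction I rule: infinite_finite_induct)
    (auto simp: ennreal_mult prod_nonneg ennreal_inverse_mult)

lemma ennreal_inverse_antimono: "a \<le> b \<Longrightarrow> inverse (b::ennreal) \<le> inverse a"
  by (cases a; cases b; cases "a = 0"; cases "b = 0")
    (auto simp: inverse_ennreal le_imp_inverse_le top_unique less_le)

lemma gram_schmidt_in_span: "gram_schmidt z i \<in> span (z ` {..i})"
proof (induction i rule: less_induct)
  case (less i)
  have "gram_schmidt z j \<in> span (z ` {..i})" if "j < i" for j
    using less.IH[OF that] span_mono[OF image_mono, of "{..j}" "{..i}" z] that by auto
  then show ?case
    by (subst gram_schmidt.simps) (intro span_diff span_sum span_scale, auto intro: span_base)
qed

text \<open>The last Gram-Schmidt vector has the same coordinates as \<open>y\<close> in \<open>m = d - k\<close> directions, so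
  its norm is at least the geometric mean of these coordinates. This bound factorizes.\<close>

lemma nn_integral_inverse_gram_schmidt_bounded:
  assumes k: "k < DIM('a::euclidean_space)" and \<beta>: "0 < \<beta>" "\<beta> < real DIM('a) - real k"
  obtains C :: ennreal where "C < \<infinity>" "\<And>z :: nat \<Rightarrow> 'a.
    (\<integral>\<^sup>+y. indicator (cball 0 1) y * inverse (ennreal (norm (gram_schmidt (z(k := y)) k) powr \<beta>)) \<partial>lborel) \<le> C"
proof -
  define m where "m = DIM('a) - k"
  \<comment> \<open>The exponent is shared equally among the \<open>m\<close> complementary
    directions; \<open>\<beta> < m\<close> is exactly what makes each one-dimensional integral
    converge.\<close>
  define \<gamma> where "\<gamma> = \<beta> / m"
  have m: "m > 0" "real m = real DIM('a) - real k" using k by (auto simp: m_def)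
  have \<gamma>: "0 < \<gamma>" "\<gamma> < 1" using \<beta> m by (auto simp: \<gamma>_def)
  define h :: "nat \<Rightarrow> real \<Rightarrow> ennreal" where
    "h i t = indicator {-1..1} t * (if i < k then 1 else inverse (ennreal (\<bar>t\<bar> powr \<gamma>)))" for i t
  have [measurable]: "h i \<in> borel_measurable borel" for i unfolding h_def by measurable
  have h_finite: "(\<integral>\<^sup>+t. h i t \<partial>lborel) < \<infinity>" for i
    using nn_integral_inverse_powr_Icc_finite[OF \<gamma>] by (cases "i < k") (simp_all add: h_def)
  show thesis
  proof (rule that)
    \<comment> \<open>This bound is fixed before \<open>z\<close> and its frame are chosen, hence
      uniform in the earlier vertices.\<close>
    show "(\<Prod>i<DIM('a). \<integral>\<^sup>+t. h i t \<partial>lborel) < \<infinity>"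
      using h_finite by (auto simp: less_top[symmetric] ennreal_prod_eq_top)
    fix z :: "nat \<Rightarrow> 'a"
    obtain e where e: "orthonormal DIM('a) e"
      and orth: "\<And>x j. x \<in> span (z ` {..<k}) \<Longrightarrow> k \<le> j \<Longrightarrow> j < DIM('a) \<Longrightarrow> x \<bullet> e j = 0"
      by (rule ex_orthonormal_flag[of z k]) (rule that)
    have "indicator (cball 0 1) y * inverse (ennreal (norm (gram_schmidt (z(k := y)) k) powr \<beta>)) \<le> (\<Prod>i<DIM('a). h i (y \<bullet> e i))"
      for y
    proof (cases "y \<in> cball 0 1")
      case True
      let ?g = "gram_schmidt (z(k := y))"
      have y_e: "\<bar>y \<bullet> e i\<bar> \<le> 1" if "i < DIM('a)" for i
      proof -
        have "norm (e i) = 1" using orthonormalD[OF e that that] by (simp add: norm_eq_1)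
        then have "\<bar>y \<bullet> e i\<bar> \<le> norm y" using Cauchy_Schwarz_ineq2[of y "e i"] by simp
        then show ?thesis using True by simp
      qed
      \<comment> \<open>What is subtracted from \<open>y\<close> lies in the span of the first
        \<open>k\<close> vectors, to which \<open>e i\<close> is orthogonal.\<close>
      have g_e: "?g k \<bullet> e i = y \<bullet> e i" if "i \<in> {k..<DIM('a)}" for i
      proof -
        have "?g j \<bullet> e i = 0" if "j < k" for j
        proof -
          have "?g j = gram_schmidt z j" using that by (intro gram_schmidt_cong) auto
          moreover have "gram_schmidt z j \<in> span (z ` {..<k})"
            using gram_schmidt_in_span[of z j] span_mono[OF image_mono, of "{..j}" "{..<k}" z] that
            by (auto simp: subset_eq)
          ultimately show ?thesis using orth \<open>i \<in> {k..<DIM('a)}\<close> by auto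
        qed
        then show ?thesis
          by (subst gram_schmidt.simps) (simp add: inner_diff_left inner_sum_left)
      qed
      have le: "\<bar>y \<bullet> e i\<bar> \<le> norm (?g k)" if "i \<in> {k..<DIM('a)}" for i
      proof -
        have "norm (e i) = 1" using orthonormalD[OF e, of i i] that by (simp add: norm_eq_1)
        then show ?thesis using Cauchy_Schwarz_ineq2[of "?g k" "e i"] g_e[OF that] by simp
      qed
      have "(\<Prod>i\<in>{k..<DIM('a)}. \<bar>y \<bullet> e i\<bar> powr \<gamma>) \<le> (\<Prod>i\<in>{k..<DIM('a)}. norm (?g k) powr \<gamma>)"
        using le \<gamma> by (intro prod_mono) (auto intro!: powr_mono2)
      also have "\<dots> = norm (?g k) powr \<beta>"
      \<comment> \<open>If the vector vanishes, both sides are 0, since \<open>k < DIM('a)\<close>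
        makes the product nonempty.\<close>
      proof (cases "?g k = 0")
        case True
        then show ?thesis using k by (simp add: prod_zero_iff)
      next
        case False
        then show ?thesis using m by (simp add: powr_power \<gamma>_def m_def[symmetric])
      qed
      finally have "inverse (ennreal (norm (?g k) powr \<beta>)) \<le> inverse (ennreal (\<Prod>i\<in>{k..<DIM('a)}. \<bar>y \<bullet> e i\<bar> powr \<gamma>))"
        by (intro ennreal_inverse_antimono ennreal_leI)
      also have "\<dots> = (\<Prod>i\<in>{k..<DIM('a)}. inverse (ennreal (\<bar>y \<bullet> e i\<bar> powr \<gamma>)))"
        by (rule inverse_ennreal_prod) simp
      also have "\<dots> = (\<Prod>i<DIM('a). h i (y \<bullet> e i))"
        using y_e by (intro prod.mono_neutral_cong_left) (auto simp: h_def indicator_def abs_le_iff)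
      finally show ?thesis using True by simp
    qed simp
    then have "(\<integral>\<^sup>+y. indicator (cball 0 1) y * inverse (ennreal (norm (gram_schmidt (z(k := y)) k) powr \<beta>)) \<partial>lborel) \<le>
        (\<integral>\<^sup>+y. (\<Prod>i<DIM('a). h i (y \<bullet> e i)) \<partial>lborel)"
      by (intro nn_integral_mono)
    also have "\<dots> = (\<Prod>i<DIM('a). \<integral>\<^sup>+t. h i t \<partial>lborel)"
      by (rule nn_integral_orthonormal_prod[OF e]) simp
    finally show "(\<integral>\<^sup>+y. indicator (cball 0 1) y * inverse (ennreal (norm (gram_schmidt (z(k := y)) k) powr \<beta>)) \<partial>lborel) \<le>
        (\<Prod>i<DIM('a). \<integral>\<^sup>+t. h i t \<partial>lborel)" .
  qed
qed

lemma inverse_gram_schmidt_measurable: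
  assumes "{1..Suc i} \<subseteq> I"
  shows "(\<lambda>x. indicator (cball 0 1) (x (Suc i)) * inverse (ennreal (norm (gram_schmidt (\<lambda>i. x (Suc i)) i) powr \<beta>)))
    \<in> borel_measurable (\<Pi>\<^sub>M i\<in>I. (lborel :: 'a::euclidean_space measure))"
proof -
  have comp [measurable]: "(\<lambda>x. x (Suc j)) \<in> borel_measurable (\<Pi>\<^sub>M i\<in>I. (lborel :: 'a measure))" if "j \<le> i" for j
    using that assms by (intro component_borel_measurable) auto
  have g: "(\<lambda>x. gram_schmidt (\<lambda>i. x (Suc i)) i) \<in> borel_measurable (\<Pi>\<^sub>M i\<in>I. (lborel :: 'a measure))"
    by (rule gram_schmidt_measurable) measurable
  have "(\<lambda>x. inverse (ennreal (norm (gram_schmidt (\<lambda>i. x (Suc i)) i) powr \<beta>))) \<in> borel_measurable (\<Pi>\<^sub>M i\<in>I. (lborel :: 'a measure))"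
    by (rule measurable_compose[OF g, of "\<lambda>v. inverse (ennreal (norm v powr \<beta>))"]) measurable
  moreover have "(\<lambda>x. indicator (cball 0 1) (x (Suc i)) :: ennreal) \<in> borel_measurable (\<Pi>\<^sub>M i\<in>I. (lborel :: 'a measure))"
    by (rule measurable_compose[OF comp[OF order_refl], of "indicator (cball 0 1)"]) (rule borel_measurable_indicator, simp)
  ultimately show ?thesis by (rule borel_measurable_times_ennreal[rotated])
qed

text \<open>As \<open>inverse 0 = \<infinity>\<close> in the extended reals, the integrand is \<open>\<infinity>\<close> at degenerate simplices, which
  therefore form a null set.\<close>

lemma nn_integral_inverse_prod_gram_schmidt_finite:
  assumes "k \<le> DIM('a::euclidean_space)" "0 < \<beta>" "\<beta> < real DIM('a) - real k + 1"
  shows "(\<integral>\<^sup>+x. (\<Prod>i<k. indicator (cball 0 1) (x (Suc i)) *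
      inverse (ennreal (norm (gram_schmidt (\<lambda>i. x (Suc i)) i) powr \<beta>))) \<partial>(\<Pi>\<^sub>M i\<in>{1..k}. (lborel :: 'a measure))) < \<infinity>"
  using assms
proof (induction k)
  case 0
  then show ?case by (simp add: PiM_empty nn_integral_count_space_finite)
next
  case (Suc k)
  interpret product_sigma_finite "\<lambda>_. lborel :: 'a measure" by standard
  let ?g = "\<lambda>(x :: nat \<Rightarrow> 'a) i. gram_schmidt (\<lambda>i. x (Suc i)) i"
  let ?f = "\<lambda>(x :: nat \<Rightarrow> 'a) i. indicator (cball 0 1) (x (Suc i)) * inverse (ennreal (norm (?g x i) powr \<beta>))"
  \<comment> \<open>For \<open>Suc k\<close> vectors the hypothesis reads
    \<open>\<beta> < d - k\<close>: this is the bound for a vertex with \<open>k\<close>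
    predecessors, and stronger than what the induction hypothesis asks.\<close>
  have IH: "(\<integral>\<^sup>+x. (\<Prod>i<k. ?f x i) \<partial>(\<Pi>\<^sub>M i\<in>{1..k}. (lborel :: 'a measure))) < \<infinity>"
    using Suc by simp
  obtain C :: ennreal where C: "C < \<infinity>" "\<And>z :: nat \<Rightarrow> 'a.
    (\<integral>\<^sup>+y. indicator (cball 0 1) y * inverse (ennreal (norm (gram_schmidt (z(k := y)) k) powr \<beta>)) \<partial>lborel) \<le> C"
    using nn_integral_inverse_gram_schmidt_bounded[where 'a = 'a, of k \<beta>] Suc.prems by auto
  have f_meas: "(\<lambda>x. ?f x i) \<in> borel_measurable (\<Pi>\<^sub>M i\<in>I. lborel)" if "{1..Suc i} \<subseteq> I" for i I
    using that by (rule inverse_gram_schmidt_measurable)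
  have ins: "{1..Suc k} = insert (Suc k) {1..k}" by auto
  have "(\<integral>\<^sup>+x. (\<Prod>i<Suc k. ?f x i) \<partial>(\<Pi>\<^sub>M i\<in>{1..Suc k}. lborel)) =
      (\<integral>\<^sup>+x. (\<integral>\<^sup>+y. (\<Prod>i<Suc k. ?f (x(Suc k := y)) i) \<partial>lborel) \<partial>(\<Pi>\<^sub>M i\<in>{1..k}. lborel))"
    unfolding ins
    by (rule product_nn_integral_insert[where f = "\<lambda>x. \<Prod>i<Suc k. ?f x i"])
      (auto intro!: borel_measurable_prod_ennreal f_meas simp del: prod.lessThan_Suc)
  also have "\<dots> = (\<integral>\<^sup>+x. (\<integral>\<^sup>+y. (\<Prod>i<k. ?f x i) * (indicator (cball 0 1) y *
      inverse (ennreal (norm (gram_schmidt ((\<lambda>i. x (Suc i))(k := y)) k) powr \<beta>))) \<partial>lborel) \<partial>(\<Pi>\<^sub>M i\<in>{1..k}. lborel))"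
  proof (intro nn_integral_cong)
    fix x :: "nat \<Rightarrow> 'a" and y :: 'a
    \<comment> \<open>The earlier Gram-Schmidt vectors do not see the last vertex, so their factors
      leave the inner integral.\<close>
    have "?g (x(Suc k := y)) i = ?g x i" if "i < k" for i
      using that by (intro gram_schmidt_cong) auto
    moreover have "(\<lambda>i. (x(Suc k := y)) (Suc i)) = (\<lambda>i. x (Suc i))(k := y)" by auto
    ultimately show "(\<Prod>i<Suc k. ?f (x(Suc k := y)) i) = (\<Prod>i<k. ?f x i) * (indicator (cball 0 1) y *
        inverse (ennreal (norm (gram_schmidt ((\<lambda>i. x (Suc i))(k := y)) k) powr \<beta>)))"
      by simp
  qed
  also have "\<dots> = (\<integral>\<^sup>+x. (\<Prod>i<k. ?f x i) * (\<integral>\<^sup>+y. indicator (cball 0 1) y *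
      inverse (ennreal (norm (gram_schmidt ((\<lambda>i. x (Suc i))(k := y)) k) powr \<beta>)) \<partial>lborel) \<partial>(\<Pi>\<^sub>M i\<in>{1..k}. lborel))"
  proof (intro nn_integral_cong nn_integral_cmult)
    fix x :: "nat \<Rightarrow> 'a"
    have [measurable]: "cball (0::'a) 1 \<in> sets borel" by simp
    have [measurable]: "(\<lambda>y. gram_schmidt ((\<lambda>i. x (Suc i))(k := y)) k) \<in> borel_measurable lborel"
      by (rule gram_schmidt_measurable) auto
    show "(\<lambda>y. indicator (cball 0 1) y * inverse (ennreal (norm (gram_schmidt ((\<lambda>i. x (Suc i))(k := y)) k) powr \<beta>)))
      \<in> borel_measurable lborel" by measurable
  qed
  also have "\<dots> \<le> (\<integral>\<^sup>+x. (\<Prod>i<k. ?f x i) * C \<partial>(\<Pi>\<^sub>M i\<in>{1..k}. lborel))"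
    by (intro nn_integral_mono mult_left_mono C) simp
  also have "\<dots> = (\<integral>\<^sup>+x. (\<Prod>i<k. ?f x i) \<partial>(\<Pi>\<^sub>M i\<in>{1..k}. lborel)) * C"
    by (intro nn_integral_multc borel_measurable_prod_ennreal f_meas) auto
  also have "\<dots> < \<infinity>" using IH C(1) by (simp add: ennreal_mult_less_top)
  finally show ?case .
qed

section \<open>Moments\<close>

text \<open>Covers divergent integrals too, as the Bochner integral and \<open>enn2real\<close> then
  both give 0.\<close>

lemma vol_moment_eq_nn_integral:
  "vol_moment TYPE('a::euclidean_space) k \<alpha> =
    enn2real (\<integral>\<^sup>+x. ennreal (simplex_vol_powr 1 \<alpha> (0 # map x [1..<k + 1])) \<partial>(\<Pi>\<^sub>M i\<in>{1..k}. (lborel :: 'a measure)))"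
proof -
  let ?N = "\<Pi>\<^sub>M i\<in>{1..k}. (lborel :: 'a measure)"
  let ?s = "\<lambda>x :: nat \<Rightarrow> 'a. simplex_vol_powr 1 \<alpha> (0 # map x [1..<k + 1])"
  \<comment> \<open>Where the power is nonzero, the edges at the origin have length at most 1, so
    all vertices lie in the unit ball already.\<close>
  have "indicator (\<Pi>\<^sub>E l\<in>{1..k}. cball 0 1) x *\<^sub>R ?s x = ?s x" if "x \<in> space ?N" for x
    using that unfolding simplex_vol_powr_eq
    by (auto simp: indicator_def space_PiM PiE_iff)
  then have "vol_moment TYPE('a) k \<alpha> = (\<integral>x. ?s x \<partial>?N)"
    unfolding vol_moment_def set_lebesgue_integral_def by (rule Bochner_Integration.integral_cong[OF refl])
  also have "\<dots> = enn2real (\<integral>\<^sup>+x. ennreal (?s x) \<partial>?N)"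
    by (rule integral_eq_nn_integral[OF simplex_vol_powr_measurable]) (simp add: simplex_vol_powr_nonneg)
  finally show ?thesis .
qed

text \<open>Lets the second simplex of a joint moment, with vertices numbered from
  \<open>k + 1\<close>, be renumbered from 1. Rectangles suffice to compare the measures.\<close>

lemma distr_shift_PiM_lborel:
  fixes k n :: nat
  shows "distr (\<Pi>\<^sub>M i\<in>{k + 1..k + n}. (lborel :: 'a::euclidean_space measure)) (\<Pi>\<^sub>M i\<in>{1..n}. lborel) (\<lambda>y. \<lambda>i\<in>{1..n}. y (i + k)) =
    (\<Pi>\<^sub>M i\<in>{1..n}. lborel)"
proof -
  interpret product_sigma_finite "\<lambda>_. lborel :: 'a measure" by standard
  let ?J = "{k + 1..k + n}" and ?sh = "\<lambda>y :: nat \<Rightarrow> 'a. \<lambda>i\<in>{1..n}. y (i + k)"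
  have sh: "?sh \<in> (\<Pi>\<^sub>M i\<in>?J. lborel) \<rightarrow>\<^sub>M (\<Pi>\<^sub>M i\<in>{1..n}. lborel)"
    by (intro measurable_restrict measurable_component_singleton) auto
  have bij: "bij_betw (\<lambda>i. i + k) {1..n} ?J"
    by (intro bij_betw_byWitness[where f' = "\<lambda>i. i - k"]) auto
  show ?thesis
  proof (rule PiM_eqI)
    fix A :: "nat \<Rightarrow> 'a set" assume A: "\<And>i. i \<in> {1..n} \<Longrightarrow> A i \<in> sets lborel"
    have "?sh -` (Pi\<^sub>E {1..n} A) \<inter> space (\<Pi>\<^sub>M i\<in>?J. lborel) = (\<Pi>\<^sub>E i\<in>?J. A (i - k))"
    proof -
      have "(\<forall>i\<in>{1..n}. y (i + k) \<in> A i) \<longleftrightarrow> (\<forall>i\<in>?J. y i \<in> A (i - k))" for y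
        using bij_betw_ball[OF bij, of "\<lambda>i. y i \<in> A (i - k)"] by simp
      then show ?thesis by (auto simp: space_PiM PiE_iff)
    qed
    moreover have "Pi\<^sub>E {1..n} A \<in> sets (\<Pi>\<^sub>M i\<in>{1..n}. lborel)"
      using A by (intro sets_PiM_I_finite) auto
    ultimately have "emeasure (distr (\<Pi>\<^sub>M i\<in>?J. lborel) (\<Pi>\<^sub>M i\<in>{1..n}. lborel) ?sh) (Pi\<^sub>E {1..n} A) =
        emeasure (\<Pi>\<^sub>M i\<in>?J. lborel) (\<Pi>\<^sub>E i\<in>?J. A (i - k))"
      using sh by (simp add: emeasure_distr)
    also have "\<dots> = (\<Prod>i\<in>?J. emeasure lborel (A (i - k)))"
      using A bij_betw_ball[OF bij, of "\<lambda>i. A (i - k) \<in> sets lborel"] by (intro emeasure_PiM) auto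
    also have "\<dots> = (\<Prod>i\<in>{1..n}. emeasure lborel (A i))"
      by (subst prod.reindex_bij_betw[OF bij, symmetric]) simp
    finally show "emeasure (distr (\<Pi>\<^sub>M i\<in>?J. lborel) (\<Pi>\<^sub>M i\<in>{1..n}. lborel) ?sh) (Pi\<^sub>E {1..n} A) =
        (\<Prod>i\<in>{1..n}. emeasure lborel (A i))" .
  qed auto
qed

text \<open>For \<open>m = 1\<close> the second list starts at \<open>k1 + 1\<close>, just after the
  first one ends, so the variables separate. Tonelli is used in the extended reals, where
  \<open>enn2real\<close> is multiplicative even at infinity, so finiteness can be settled
  separately.\<close>

lemma joint_vol_moment_1:
  "joint_vol_moment TYPE('a::euclidean_space) k1 k2 1 \<alpha>1 \<alpha>2 = vol_moment TYPE('a) k1 \<alpha>1 * vol_moment TYPE('a) k2 \<alpha>2"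
proof -
  interpret product_sigma_finite "\<lambda>_. lborel :: 'a measure" by standard
  let ?I = "{1..k1}" and ?J = "{k1 + 1..k1 + k2}"
  let ?N = "\<lambda>I. \<Pi>\<^sub>M i\<in>I. (lborel :: 'a measure)"
  let ?s1 = "\<lambda>x :: nat \<Rightarrow> 'a. simplex_vol_powr 1 \<alpha>1 (0 # map x [1..<k1 + 1])"
  let ?s2 = "\<lambda>x :: nat \<Rightarrow> 'a. simplex_vol_powr 1 \<alpha>2 (0 # map x [1..<k2 + 1])"
  let ?t2 = "\<lambda>x :: nat \<Rightarrow> 'a. simplex_vol_powr 1 \<alpha>2 (0 # map x [k1 + 1..<k1 + k2 + 1])"
  have t2: "?t2 x = ?s2 (\<lambda>i. x (i + k1))" for x
  proof -
    have "map x [k1 + 1..<k1 + k2 + 1] = map (\<lambda>i. x (i + k1)) [1..<k2 + 1]"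
      by (rule nth_equalityI) (auto simp: add_ac simp del: upt_Suc)
    then show ?thesis by (simp only:)
  qed
  have s_cong: "simplex_vol_powr 1 \<alpha> (0 # map x [1..<k + 1]) = simplex_vol_powr 1 \<alpha> (0 # map y [1..<k + 1])"
    if "\<And>i. i \<in> {1..k} \<Longrightarrow> x i = y i" for x y :: "nat \<Rightarrow> 'a" and \<alpha> k
  proof -
    have "map x [1..<k + 1] = map y [1..<k + 1]" using that by auto
    then show ?thesis by (simp only:)
  qed
  have IJ: "{1..k1 + k2} = ?I \<union> ?J" "?I \<inter> ?J = {}" by auto
  have s1_meas: "?s1 \<in> borel_measurable (?N I)" if "?I \<subseteq> I" for I
  proof -
    \<comment> \<open>Only the first \<open>k1\<close> coordinates enter, so measurability on a
      larger product follows by composing with the restriction.\<close>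
    have restr: "?s1 (restrict x {1..k1}) = ?s1 x" for x by (rule s_cong) simp
    have "(\<lambda>x. \<lambda>i\<in>{1..k1}. x i) \<in> ?N I \<rightarrow>\<^sub>M ?N ?I"
      using that by (intro measurable_restrict measurable_component_singleton) auto
    from measurable_compose[OF this simplex_vol_powr_measurable[of \<alpha>1 k1]]
    show ?thesis by (simp only: restr)
  qed
  have t2_shift: "?t2 x = ?s2 (\<lambda>i\<in>{1..k2}. x (i + k1))" for x
    unfolding t2 by (rule s_cong) simp
  have shift: "(\<lambda>x. \<lambda>i\<in>{1..k2}. x (i + k1)) \<in> ?N I \<rightarrow>\<^sub>M ?N {1..k2}" if "?J \<subseteq> I" for I
    using that by (intro measurable_restrict measurable_component_singleton) auto
  have t2_meas: "?t2 \<in> borel_measurable (?N I)" if "?J \<subseteq> I" for I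
    unfolding t2_shift using measurable_compose[OF shift[OF that] simplex_vol_powr_measurable[of \<alpha>2 k2]] .
  have meas: "(\<lambda>x. ?s1 x * ?t2 x) \<in> borel_measurable (?N {1..k1 + k2})"
    by (intro borel_measurable_times s1_meas t2_meas) auto
  have "indicator (\<Pi>\<^sub>E l\<in>{1..k1 + k2}. cball 0 1) x *\<^sub>R (?s1 x * ?t2 x) = ?s1 x * ?t2 x"
    if "x \<in> space (?N {1..k1 + k2})" for x
  proof (cases "?s1 x * ?t2 x = 0")
    case False
    then have x: "\<forall>i\<in>{1..k1}. norm (x i) \<le> 1" "\<forall>i\<in>{1..k2}. norm (x (i + k1)) \<le> 1"
      unfolding t2 simplex_vol_powr_eq by (auto split: if_splits)
    have "norm (x i) \<le> 1" if "i \<in> {1..k1 + k2}" for i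
    proof (cases "i \<le> k1")
      case False
      then have "i - k1 \<in> {1..k2}" using that by auto
      then show ?thesis using x(2)[rule_format, of "i - k1"] False by simp
    qed (use that x(1) in auto)
    then have "x \<in> (\<Pi>\<^sub>E l\<in>{1..k1 + k2}. cball 0 1)"
      using that by (auto simp: space_PiM PiE_iff)
    then show ?thesis by simp
  qed simp
  then have "joint_vol_moment TYPE('a) k1 k2 1 \<alpha>1 \<alpha>2 = (\<integral>x. ?s1 x * ?t2 x \<partial>?N {1..k1 + k2})"
    unfolding joint_vol_moment_def set_lebesgue_integral_def
    by (intro Bochner_Integration.integral_cong) (simp_all del: upt_Suc)
  also have "\<dots> = enn2real (\<integral>\<^sup>+x. ennreal (?s1 x * ?t2 x) \<partial>?N {1..k1 + k2})"
    by (rule integral_eq_nn_integral[OF meas]) (simp add: simplex_vol_powr_nonneg)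
  also have "(\<integral>\<^sup>+x. ennreal (?s1 x * ?t2 x) \<partial>?N {1..k1 + k2}) =
      (\<integral>\<^sup>+x. \<integral>\<^sup>+y. ennreal (?s1 (merge ?I ?J (x, y)) * ?t2 (merge ?I ?J (x, y))) \<partial>?N ?J \<partial>?N ?I)"
    unfolding IJ(1)
    by (rule product_nn_integral_fold[OF IJ(2) _ _ measurable_compose[OF meas[unfolded IJ(1)] measurable_ennreal]]) simp_all
  also have "\<dots> = (\<integral>\<^sup>+x. \<integral>\<^sup>+y. ennreal (?s1 x) * ennreal (?t2 y) \<partial>?N ?J \<partial>?N ?I)"
  proof (intro nn_integral_cong)
    fix x y :: "nat \<Rightarrow> 'a"
    have "?s1 (merge ?I ?J (x, y)) = ?s1 x" by (rule s_cong) (simp add: merge_def)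
    moreover have "?t2 (merge ?I ?J (x, y)) = ?t2 y"
      unfolding t2 by (rule s_cong) (simp add: merge_def)
    ultimately show "ennreal (?s1 (merge ?I ?J (x, y)) * ?t2 (merge ?I ?J (x, y))) = ennreal (?s1 x) * ennreal (?t2 y)"
      by (simp only: ennreal_mult simplex_vol_powr_nonneg)
  qed
  also have "\<dots> = (\<integral>\<^sup>+x. ennreal (?s1 x) * (\<integral>\<^sup>+y. ennreal (?t2 y) \<partial>?N ?J) \<partial>?N ?I)"
    by (intro nn_integral_cong nn_integral_cmult measurable_compose[OF _ measurable_ennreal] t2_meas order_refl)
  also have "\<dots> = (\<integral>\<^sup>+x. ennreal (?s1 x) \<partial>?N ?I) * (\<integral>\<^sup>+y. ennreal (?t2 y) \<partial>?N ?J)"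
    by (intro nn_integral_multc measurable_compose[OF _ measurable_ennreal] s1_meas order_refl)
  also have "(\<integral>\<^sup>+y. ennreal (?t2 y) \<partial>?N ?J) = (\<integral>\<^sup>+x. ennreal (?s2 x) \<partial>?N {1..k2})"
    unfolding t2_shift
    using nn_integral_distr[OF shift[OF order_refl], unfolded measurable_distr_eq1 distr_shift_PiM_lborel,
        OF measurable_compose[OF simplex_vol_powr_measurable[of \<alpha>2 k2] measurable_ennreal]]
    by (rule sym)
  finally show ?thesis by (simp add: vol_moment_eq_nn_integral enn2real_mult del: upt_Suc)
qed

section \<open>Finiteness and positivity of the moments\<close>

lemma simplex_volume_nonneg: "0 \<le> simplex_volume k x"
  by (simp add: simplex_volume_def prod_nonneg)

lemma simplex_volume_le_1:
  assumes "\<And>i. i \<in> {1..k} \<Longrightarrow> norm (x i) \<le> 1"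
  shows "simplex_volume k x \<le> 1"
proof -
  have "(\<Prod>i<k. norm (gram_schmidt (\<lambda>i. x (Suc i)) i)) \<le> (\<Prod>i<k. 1)"
    using assms by (intro prod_mono conjI norm_ge_zero order_trans[OF norm_gram_schmidt_le]) auto
  also have "\<dots> \<le> fact k" by (simp add: fact_ge_1)
  finally show ?thesis by (simp add: simplex_volume_def divide_le_eq_1)
qed

text \<open>The exponent 1/2 lies below \<open>d - k + 1\<close> for every \<open>k \<le> d\<close>,
  so the inverse product has a finite integral and is finite almost everywhere.\<close>

lemma AE_simplex_volume_pos:
  "AE x in (\<Pi>\<^sub>M i\<in>{1..k}. (lborel :: 'a::euclidean_space measure)). (\<forall>i\<in>{1..k}. norm (x i) \<le> 1) \<longrightarrow> 0 < simplex_volume k x"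
proof (cases "k \<le> DIM('a)")
  case True
  let ?f = "\<lambda>(x :: nat \<Rightarrow> 'a) i. indicator (cball 0 1) (x (Suc i)) *
    inverse (ennreal (norm (gram_schmidt (\<lambda>i. x (Suc i)) i) powr (1/2)))"
  have "AE x in (\<Pi>\<^sub>M i\<in>{1..k}. (lborel :: 'a measure)). (\<Prod>i<k. ?f x i) \<noteq> \<infinity>"
    using nn_integral_inverse_prod_gram_schmidt_finite[where 'a = 'a, of k "1/2"] True
    by (intro nn_integral_PInf_AE borel_measurable_prod_ennreal inverse_gram_schmidt_measurable) auto
  then show ?thesis
  proof eventually_elim
    case (elim x)
    show ?case
    proof
      assume x: "\<forall>i\<in>{1..k}. norm (x i) \<le> 1"
      \<comment> \<open>Inside the unit balls no factor is 0, so a single infinite factor would make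
        the whole product infinite.\<close>
      have "gram_schmidt (\<lambda>i. x (Suc i)) i \<noteq> 0" if "i < k" for i
        using elim x that by (auto simp: ennreal_prod_eq_top indicator_def)
      then show "0 < simplex_volume k x" by (auto simp: simplex_volume_def intro!: divide_pos_pos prod_pos)
    qed
  qed
next
  case False
  then show ?thesis by (simp add: simplex_volume_def)
qed

text \<open>A negative power is dominated by the inverse product with exponent
  \<open>- \<alpha>\<close>; the constant \<open>fact k powr (- \<alpha>)\<close> is the
  normalization \<open>1 / fact k\<close> raised to \<open>\<alpha>\<close>. For
  \<open>\<alpha> \<ge> 0\<close> the volume is at most 1, so the integrand is bounded by the
  indicator of a product of balls.\<close>

lemma nn_integral_simplex_vol_powr_finite:
  assumes \<alpha>: "\<alpha> > - real DIM('a::euclidean_space) + real k - 1" "k > DIM('a) \<Longrightarrow> \<alpha> = 0"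
  shows "(\<integral>\<^sup>+x. ennreal (simplex_vol_powr 1 \<alpha> (0 # map x [1..<k + 1])) \<partial>(\<Pi>\<^sub>M i\<in>{1..k}. (lborel :: 'a measure))) < \<infinity>"
proof (cases "\<alpha> < 0")
  case True
  then have k: "k \<le> DIM('a)" using \<alpha>(2) by (cases "k \<le> DIM('a)") auto
  let ?f = "\<lambda>(x :: nat \<Rightarrow> 'a) i. indicator (cball 0 1) (x (Suc i)) *
    inverse (ennreal (norm (gram_schmidt (\<lambda>i. x (Suc i)) i) powr (- \<alpha>)))"
  have "ennreal (simplex_vol_powr 1 \<alpha> (0 # map x [1..<k + 1])) \<le> ennreal (fact k powr (- \<alpha>)) * (\<Prod>i<k. ?f x i)"
    (is "_ \<le> ?r") for x :: "nat \<Rightarrow> 'a"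
  proof (cases "simplex_vol_powr 1 \<alpha> (0 # map x [1..<k + 1]) = 0")
    case False
    then have x: "\<forall>i\<in>{1..k}. norm (x i) \<le> 1" and V: "simplex_volume k x \<noteq> 0"
      and eq: "simplex_vol_powr 1 \<alpha> (0 # map x [1..<k + 1]) = simplex_volume k x powr \<alpha>"
      unfolding simplex_vol_powr_eq by (auto split: if_splits)
    let ?g = "\<lambda>i. norm (gram_schmidt (\<lambda>i. x (Suc i)) i)"
    have g: "0 < ?g i" if "i < k" for i
      using V that k by (auto simp: simplex_volume_def prod_zero_iff)
    have "simplex_volume k x powr \<alpha> = fact k powr (- \<alpha>) * (\<Prod>i<k. ?g i powr \<alpha>)"
      using k by (simp add: simplex_volume_def powr_divide powr_minus_divide prod_nonneg prod_powr_distrib)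
    also have "ennreal \<dots> = ennreal (fact k powr (- \<alpha>)) * (\<Prod>i<k. ennreal (?g i powr \<alpha>))"
      by (simp add: ennreal_mult prod_nonneg prod_ennreal)
    also have "(\<Prod>i<k. ennreal (?g i powr \<alpha>)) = (\<Prod>i<k. ?f x i)"
      using g x by (intro prod.cong) (auto simp: inverse_ennreal powr_minus)
    finally show ?thesis by (simp only: eq)
  qed simp
  then have "(\<integral>\<^sup>+x. ennreal (simplex_vol_powr 1 \<alpha> (0 # map x [1..<k + 1])) \<partial>(\<Pi>\<^sub>M i\<in>{1..k}. (lborel :: 'a measure))) \<le>
      (\<integral>\<^sup>+x. ennreal (fact k powr (- \<alpha>)) * (\<Prod>i<k. ?f x i) \<partial>(\<Pi>\<^sub>M i\<in>{1..k}. (lborel :: 'a measure)))"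
    by (intro nn_integral_mono)
  also have "\<dots> = ennreal (fact k powr (- \<alpha>)) * (\<integral>\<^sup>+x. (\<Prod>i<k. ?f x i) \<partial>(\<Pi>\<^sub>M i\<in>{1..k}. (lborel :: 'a measure)))"
    by (intro nn_integral_cmult borel_measurable_prod_ennreal inverse_gram_schmidt_measurable) auto
  also have "\<dots> < \<infinity>"
    using nn_integral_inverse_prod_gram_schmidt_finite[where 'a = 'a, of k "- \<alpha>"] True \<alpha>(1) k
    by (simp add: ennreal_mult_less_top)
  finally show ?thesis .
next
  case False
  let ?B = "\<Pi>\<^sub>E i\<in>{1..k}. cball (0::'a) 1"
  interpret product_sigma_finite "\<lambda>_. lborel :: 'a measure" by standard
  have "ennreal (simplex_vol_powr 1 \<alpha> (0 # map x [1..<k + 1])) \<le> indicator ?B x"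
    if "x \<in> space (\<Pi>\<^sub>M i\<in>{1..k}. (lborel :: 'a measure))" for x
    using that False simplex_volume_le_1[of k x] simplex_volume_nonneg[of k x] unfolding simplex_vol_powr_eq
    by (auto simp: indicator_def space_PiM PiE_iff intro!: powr_le1)
  then have "(\<integral>\<^sup>+x. ennreal (simplex_vol_powr 1 \<alpha> (0 # map x [1..<k + 1])) \<partial>(\<Pi>\<^sub>M i\<in>{1..k}. (lborel :: 'a measure))) \<le>
      (\<integral>\<^sup>+x. indicator ?B x \<partial>(\<Pi>\<^sub>M i\<in>{1..k}. (lborel :: 'a measure)))"
    by (intro nn_integral_mono)
  also have "\<dots> = emeasure (\<Pi>\<^sub>M i\<in>{1..k}. (lborel :: 'a measure)) ?B"
    by (intro nn_integral_indicator sets_PiM_I_finite) auto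
  also have "\<dots> = (\<Prod>i\<in>{1..k}. emeasure lborel (cball (0::'a) 1))"
    by (intro emeasure_PiM) auto
  also have "\<dots> < \<infinity>"
    using emeasure_lborel_cball_finite[of "0::'a" 1] by (simp add: power_less_top_ennreal)
  finally show ?thesis .
qed

lemma vol_moment_pos:
  assumes "\<alpha> > - real DIM('a::euclidean_space) + real k - 1" "k > DIM('a) \<Longrightarrow> \<alpha> = 0"
  shows "0 < vol_moment TYPE('a) k \<alpha>"
proof -
  interpret product_sigma_finite "\<lambda>_. lborel :: 'a measure" by standard
  let ?N = "\<Pi>\<^sub>M i\<in>{1..k}. (lborel :: 'a measure)"
  let ?s = "\<lambda>x :: nat \<Rightarrow> 'a. simplex_vol_powr 1 \<alpha> (0 # map x [1..<k + 1])"
  \<comment> \<open>Radius 1/2 keeps all mutual distances at most 1 by the triangle inequality, so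
    on this set of positive measure the integrand is positive almost everywhere.\<close>
  let ?H = "\<Pi>\<^sub>E i\<in>{1..k}. cball (0::'a) (1/2)"
  have H: "?H \<in> sets ?N" by (intro sets_PiM_I_finite) auto
  have "(\<integral>\<^sup>+x. ennreal (?s x) \<partial>?N) \<noteq> 0"
  proof
    assume "(\<integral>\<^sup>+x. ennreal (?s x) \<partial>?N) = 0"
    then have "AE x in ?N. ennreal (?s x) = 0"
      by (rule nn_integral_0_iff_AE[OF measurable_compose[OF simplex_vol_powr_measurable measurable_ennreal], THEN iffD1])
    then have "AE x in ?N. x \<notin> ?H"
      using AE_simplex_volume_pos[of k]
    proof eventually_elim
      case (elim x)
      show ?case
      proof
        assume "x \<in> ?H"
        then have x: "norm (x i) \<le> 1/2" if "i \<in> {1..k}" for i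
          using that by (auto simp: PiE_iff)
        have "norm (x i - x j) \<le> 1" if "i \<in> {1..k}" "j \<in> {1..k}" for i j
          using norm_triangle_ineq4[of "x i" "x j"] x[OF that(1)] x[OF that(2)] by linarith
        moreover have "norm (x i) \<le> 1" if "i \<in> {1..k}" for i
          using x[OF that] by linarith
        ultimately have "?s x = simplex_volume k x powr \<alpha>" "0 < simplex_volume k x"
          using elim(2) unfolding simplex_vol_powr_eq by auto
        then show False using elim(1) by (simp add: ennreal_eq_0_iff)
      qed
    qed
    then have "emeasure ?N ?H = 0"
      using AE_iff_measurable[OF H, of "\<lambda>x. x \<notin> ?H"] sets.sets_into_space[OF H] by auto
    moreover have "emeasure ?N ?H = (\<Prod>i\<in>{1..k}. emeasure lborel (cball (0::'a) (1/2)))"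
      by (intro emeasure_PiM) auto
    moreover have "emeasure lborel (cball (0::'a) (1/2)) \<noteq> 0"
      using content_cball_pos[of "1/2" "0::'a"] by (auto simp: measure_def)
    ultimately show False by simp
  qed
  then show ?thesis
    using nn_integral_simplex_vol_powr_finite[OF assms]
    unfolding vol_moment_eq_nn_integral by (auto simp: enn2real_positive_iff zero_less_iff_neq_zero simp del: upt_Suc)
qed

section \<open>Matrices\<close>

lemma one_based_mat_carrier [simp]: "one_based_mat n f \<in> carrier_mat n n"
  by (simp add: one_based_mat_def)

lemma one_based_mat_cong:
  "(\<And>i j. i \<in> {1..n} \<Longrightarrow> j \<in> {1..n} \<Longrightarrow> f i j = g i j) \<Longrightarrow> one_based_mat n f = one_based_mat n g"
  unfolding one_based_mat_def by (rule eq_matI) auto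

lemma transpose_one_based_mat: "transpose_mat (one_based_mat n f) = one_based_mat n (\<lambda>i j. f j i)"
  unfolding one_based_mat_def by (rule eq_matI) auto

lemma sum_Suc_shift: "(\<Sum>l\<in>{0..<n}. h (Suc l)) = (\<Sum>l\<in>{1..n}. h l)"
  by (rule sum.reindex_bij_witness[where i = "\<lambda>l. l - 1" and j = Suc]) auto

lemma one_based_mat_mult:
  "one_based_mat n f * one_based_mat n g = one_based_mat n (\<lambda>i j. \<Sum>l\<in>{1..n}. f i l * g l j)"
  for f g :: "nat \<Rightarrow> nat \<Rightarrow> 'b::semiring_0"
proof (rule eq_matI)
  fix i j assume "i < dim_row (one_based_mat n (\<lambda>i j. \<Sum>l\<in>{1..n}. f i l * g l j))"
    "j < dim_col (one_based_mat n (\<lambda>i j. \<Sum>l\<in>{1..n}. f i l * g l j))"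
  then show "(one_based_mat n f * one_based_mat n g) $$ (i, j) = one_based_mat n (\<lambda>i j. \<Sum>l\<in>{1..n}. f i l * g l j) $$ (i, j)"
    using sum_Suc_shift[of "\<lambda>l. f (Suc i) l * g l (Suc j)" n]
    by (simp add: one_based_mat_def scalar_prod_def)
qed (simp_all add: one_based_mat_def)

lemma one_based_mat_square: "one_based_mat n f ^\<^sub>m 2 = one_based_mat n f * one_based_mat n f"
  for f :: "nat \<Rightarrow> nat \<Rightarrow> 'b::semiring_1"
  by (simp add: numeral_2_eq_2 one_based_mat_def)

text \<open>The quadratic form is the square of the linear form with coefficients
  \<open>m\<close>.\<close>

lemma rank_one_pos_semidefinite: "pos_semidefinite n (one_based_mat n (\<lambda>i j. m i * m j))"
  unfolding pos_semidefinite_def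
proof (intro conjI ballI)
  show "transpose_mat (one_based_mat n (\<lambda>i j. m i * m j)) = one_based_mat n (\<lambda>i j. m i * m j)"
    by (simp add: transpose_one_based_mat mult.commute)
  fix v :: "real Matrix.vec" assume "v \<in> carrier_vec n"
  then have "scalar_prod v (one_based_mat n (\<lambda>i j. m i * m j) *\<^sub>v v) =
      (\<Sum>i\<in>{0..<n}. \<Sum>j\<in>{0..<n}. (m (Suc i) * vec_index v i) * (m (Suc j) * vec_index v j))"
    by (auto simp: scalar_prod_def one_based_mat_def sum_distrib_left mult_ac intro!: sum.cong)
  also have "\<dots> = (\<Sum>i\<in>{0..<n}. m (Suc i) * vec_index v i)\<^sup>2"
    by (simp add: power2_eq_square sum_product)
  finally show "scalar_prod v (one_based_mat n (\<lambda>i j. m i * m j) *\<^sub>v v) \<ge> 0" by simp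
qed simp

theorem theorem5p4:
  fixes n :: nat and k :: "nat \<Rightarrow> nat" and \<alpha> :: "nat \<Rightarrow> real"
    and a :: "nat \<Rightarrow> real" and \<Sigma> :: "real mat"
  assumes "n \<ge> 2"
    and "admissible CARD('d::finite) n k \<alpha>"
    and "\<Sigma> = supercritical_cov TYPE(real ^ 'd) n k \<alpha>"
    and "\<And>i. i \<in> {1..n} \<Longrightarrow> a i = fact (k i) / vol_moment TYPE(real ^ 'd) (k i) (\<alpha> i)"
  shows "lu_decomposition n \<Sigma>
           (one_based_mat n (\<lambda>i j. if i = j then 1 else if i > 1 \<and> j = 1 then a 1 / a i else 0))
           (one_based_mat n (\<lambda>i j. if i = 1 then 1 / (a 1 * a j) else 0)) \<and>
         cholesky_decomposition n \<Sigma> (one_based_mat n (\<lambda>i j. if j = 1 then 1 / a i else 0)) \<and>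
         one_based_mat n (\<lambda>i j. (\<Prod>l\<in>{1..n}. a l) /
            (a i * a j * sqrt (\<Sum>l\<in>{1..n}. \<Prod>q\<in>{1..n} - {l}. (a q)\<^sup>2))) ^\<^sub>m 2 = \<Sigma>"
proof -
  have a_pos: "0 < a i" if "i \<in> {1..n}" for i
  proof -
    have "0 < vol_moment TYPE(real ^ 'd) (k i) (\<alpha> i)"
      using assms(2) that by (intro vol_moment_pos) (auto simp: admissible_def)
    then show ?thesis using assms(4)[OF that] by simp
  qed
  define b where "b i = 1 / a i" for i
  have b_pos: "0 < b i" if "i \<in> {1..n}" for i using a_pos[OF that] by (simp add: b_def)
  have \<Sigma>: "\<Sigma> = one_based_mat n (\<lambda>i j. b i * b j)"
    unfolding assms(3) supercritical_cov_def joint_vol_moment_1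
    by (rule one_based_mat_cong) (simp add: assms(4) b_def)
  have sum_1: "(\<Sum>l\<in>{1..n}. if l = 1 then h l else 0) = h 1" for h :: "nat \<Rightarrow> real"
    using assms(1) by simp
  let ?L = "\<lambda>i j. if i = j then 1 else if i > 1 \<and> j = 1 then a 1 / a i else 0"
  let ?U = "\<lambda>i j. if i = 1 then 1 / (a 1 * a j) else 0"
  have "\<Sigma> = one_based_mat n ?L * one_based_mat n ?U"
    unfolding \<Sigma> one_based_mat_mult
  proof (rule one_based_mat_cong)
    fix i j assume ij: "i \<in> {1..n}" "j \<in> {1..n}"
    \<comment> \<open>\<open>U\<close> vanishes below its first row, so only the first column of
      \<open>L\<close> enters the product.\<close>
    have "(\<Sum>l\<in>{1..n}. ?L i l * ?U l j) = (\<Sum>l\<in>{1..n}. if l = 1 then ?L i l * (1 / (a 1 * a j)) else 0)"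
      by (intro sum.cong) auto
    also have "\<dots> = ?L i 1 * (1 / (a 1 * a j))" by (rule sum_1)
    also have "\<dots> = b i * b j"
      using ij a_pos[of 1] a_pos[OF ij(1)] assms(1) by (auto simp: b_def)
    finally show "b i * b j = (\<Sum>l\<in>{1..n}. ?L i l * ?U l j)" by simp
  qed
  then have "lu_decomposition n \<Sigma> (one_based_mat n ?L) (one_based_mat n ?U)"
    by (auto simp: lu_decomposition_def lower_triangular_def one_based_mat_def)
  moreover
  let ?G = "\<lambda>i j. if j = 1 then 1 / a i else 0"
  have "\<Sigma> = one_based_mat n ?G * transpose_mat (one_based_mat n ?G)"
    unfolding \<Sigma> transpose_one_based_mat one_based_mat_mult
  proof (rule one_based_mat_cong)
    fix i j
    have "(\<Sum>l\<in>{1..n}. ?G i l * ?G j l) = (\<Sum>l\<in>{1..n}. if l = 1 then b i * b j else 0)"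
      by (intro sum.cong) (auto simp: b_def)
    then show "b i * b j = (\<Sum>l\<in>{1..n}. ?G i l * ?G j l)" unfolding sum_1 by simp
  qed
  then have "cholesky_decomposition n \<Sigma> (one_based_mat n ?G)"
    using rank_one_pos_semidefinite[of n b] \<Sigma>
    by (auto simp: cholesky_decomposition_def lower_triangular_def one_based_mat_def)
  moreover
  let ?P = "\<Prod>l\<in>{1..n}. a l" and ?s = "\<Sum>l\<in>{1..n}. (b l)\<^sup>2"
  let ?B = "\<lambda>i j. ?P / (a i * a j * sqrt (\<Sum>l\<in>{1..n}. \<Prod>q\<in>{1..n} - {l}. (a q)\<^sup>2))"
  have P: "?P > 0" using a_pos by (intro prod_pos) auto
  have s: "?s > 0" using b_pos assms(1) by (intro sum_pos) (auto simp: less_imp_neq[symmetric])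
  \<comment> \<open>A root of \<open>b b^t\<close> is \<open>b b^t\<close> divided by the norm of
    \<open>b\<close>, since squaring it produces the squared norm \<open>?s\<close> once. The stated
    entries are this with \<open>b l = 1 / a l\<close> and denominators cleared by
    \<open>?P\<close>.\<close>
  have B: "?B i j = b i * b j / sqrt ?s" for i j
  proof -
    have "(\<Prod>q\<in>{1..n} - {l}. (a q)\<^sup>2) = ?P\<^sup>2 * (b l)\<^sup>2" if "l \<in> {1..n}" for l
      using prod.remove[OF _ that, of a] a_pos[OF that]
      by (simp add: prod_power_distrib b_def power_mult_distrib power_divide)
    then have "(\<Sum>l\<in>{1..n}. \<Prod>q\<in>{1..n} - {l}. (a q)\<^sup>2) = ?P\<^sup>2 * ?s"
      by (simp add: sum_distrib_left)
    then have "?B i j = ?P / (a i * a j * (?P * sqrt ?s))"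
      using P by (simp only: real_sqrt_mult real_sqrt_abs abs_of_pos)
    also have "\<dots> = b i * b j / sqrt ?s"
      using nonzero_divide_mult_cancel_left[of ?P "a i * a j * sqrt ?s"] P
      by (simp only: b_def times_divide_times_eq divide_divide_eq_left mult.left_commute mult_1)
    finally show ?thesis .
  qed
  have "one_based_mat n ?B ^\<^sub>m 2 = \<Sigma>"
    unfolding \<Sigma> one_based_mat_square one_based_mat_mult B
  proof (rule one_based_mat_cong)
    fix i j
    have "(\<Sum>l\<in>{1..n}. (b i * b l / sqrt ?s) * (b l * b j / sqrt ?s)) = (\<Sum>l\<in>{1..n}. (b i * b j / ?s) * (b l)\<^sup>2)"
      using s by (intro sum.cong) (auto simp: power2_eq_square)
    also have "\<dots> = b i * b j / ?s * ?s" by (simp only: sum_distrib_left)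
    also have "\<dots> = b i * b j" using s by (metis less_irrefl nonzero_divide_eq_eq)
    finally show "(\<Sum>l\<in>{1..n}. (b i * b l / sqrt ?s) * (b l * b j / sqrt ?s)) = b i * b j" .
  qed
  ultimately show ?thesis by blast
qed

end
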